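(* There exists a family $(Z_t)_{t\ge 0}$ of $\mathbb{Z}^+$-valued random variables, each $Z_t$ being a measurable function of the trapping landscape $\sigma$, such that, as $t\to\infty$, \[ P_\sigma(X_t = Z_t)\to 1 \quad\text{in } \mathbf{P}\text{-probability}. \]
   Context: Let $\mathbb{Z}^+=\{0,1,2,\dots\}$. Let $\sigma=(\sigma_x)_{x\in\mathbb{Z}^+}$ be i.i.d. strictly positive random variables on a probability space with probability measure $\mathbf{P}$ (the trapping landscape). Define $L(u):=1/\mathbf{P}(\sigma_0>u)$ (non-decreasing, unbounded, càdlàg) and assume it is slowly varying: $\lim_{u\to\infty}L(uv)/L(u)=1$ for all $v>0$. Conditional on $\sigma$, $X=(X_t)_{t\ge0}$ (the Bouchaud trap model) is the continuous-time Markov chain on $\mathbb{Z}^+$ started from $0$ which jumps from $x$ to each nearest neighbour $y$ of $x$ in $\mathbb{Z}^+$ at rate $1/(2\sigma_x)$ (and to no other site). $P_\sigma$ denotes the law of $X$ conditional on $\sigma$ (the quenched law). *)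

theory Defs
  imports "HOL-Probability.Probability"
begin

text \<open>Bouchaud trap model on the nonnegative integers, constructed from its
  jump chain and exponential holding times.  A landscape is a function
  s :: nat => real (site x has trap depth s x).  The driving noise is an i.i.d.
  sequence of pairs (coin, E) with coin a fair Boolean and E ~ Exp(1).\<close>

text \<open>Total jump rate at site x: at x >= 1 two neighbours each at rate 1/(2 s x);
  at x = 0 only the neighbour 1, at rate 1/(2 s 0).\<close>
definition btm_rate :: "(nat \<Rightarrow> real) \<Rightarrow> nat \<Rightarrow> real" where
  "btm_rate s x = (if x = 0 then 1 / (2 * s 0) else 1 / s x)"

fun btm_walk :: "(nat \<Rightarrow> bool \<times> real) \<Rightarrow> nat \<Rightarrow> nat" where
  "btm_walk \<omega> 0 = 0"
| "btm_walk \<omega> (Suc n) =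
     (if btm_walk \<omega> n = 0 then 1
      else if fst (\<omega> n) then btm_walk \<omega> n + 1 else btm_walk \<omega> n - 1)"

definition btm_jump_time :: "(nat \<Rightarrow> real) \<Rightarrow> (nat \<Rightarrow> bool \<times> real) \<Rightarrow> nat \<Rightarrow> real" where
  "btm_jump_time s \<omega> n = (\<Sum>k<n. snd (\<omega> k) / btm_rate s (btm_walk \<omega> k))"

text \<open>Position at time t: Y_n where T_n <= t < T_(n+1).  On the (null) explosion
  event we set the position to 0.\<close>
definition btm_pos :: "(nat \<Rightarrow> real) \<Rightarrow> (nat \<Rightarrow> bool \<times> real) \<Rightarrow> real \<Rightarrow> nat" where
  "btm_pos s \<omega> t =
     (if \<exists>n. t < btm_jump_time s \<omega> (Suc n)
      then btm_walk \<omega> (LEAST n. t < btm_jump_time s \<omega> (Suc n)) else 0)"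

definition btm_noise :: "(nat \<Rightarrow> bool \<times> real) measure" where
  "btm_noise = PiM UNIV (\<lambda>_::nat.
      pair_measure (measure_pmf (bernoulli_pmf (1/2)))
                   (density lborel (\<lambda>x. ennreal (exponential_density 1 x))))"

definition quenched_prob :: "(nat \<Rightarrow> real) \<Rightarrow> real \<Rightarrow> nat \<Rightarrow> real" where
  "quenched_prob s t y = measure btm_noise {\<omega> \<in> space btm_noise. btm_pos s \<omega> t = y}"

end

theory Submission
  imports Defs
begin

text \<open>
  Let \<open>q u = P(\<sigma>\<^sub>0 > u)\<close>, choose a level \<open>u\<close> with \<open>u / q u\<close> of order \<open>t\<close>, and let \<open>Z\<^sub>t\<close> be the
  first site whose trap is deeper than \<open>u\<close>. Slow variation gives, with high probability and on the
  scale \<open>1 / q u\<close> of \<open>Z\<^sub>t\<close>: the trap at \<open>Z\<^sub>t\<close> is much deeper than \<open>u\<close>, no other trap deeper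
  than \<open>u\<close> lies before \<open>Z\<^sub>t + r\<close> with \<open>r = \<delta> / q u\<close>, and all the shallower traps up to there add
  up to \<open>o(u)\<close>. Union bounds over the sites suffice, so no conditioning on \<open>Z\<^sub>t\<close> is needed.

  For a fixed landscape \<open>s\<close>, the probability of not being at \<open>z\<close> at time \<open>t\<close> is at most the sum of
  three terms: that \<open>z\<close> has not been reached by time \<open>t\<close> (Markov's inequality for the hitting
  time); that \<open>t\<close> falls into an excursion away from \<open>z\<close>, at most the mean excursion length times
  the rate of leaving \<open>z\<close>; and that an excursion has reached \<open>z + r\<close>, at most \<open>t / (r s\<^sub>z)\<close>.
  These terms form a supersolution of the backward equation in its integrated, first-jump form, so
  that the bound follows by induction on the number of jumps, without the Markov property at stopping
  times. The possibility of \<open>n\<close> jumps before time \<open>t\<close> costs an extra \<open>\<theta>\<^sup>n e\<^sup>t\<close> with \<open>\<theta> < 1\<close>.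
\<close>

section \<open>The driving noise\<close>

abbreviation exp1 :: "real measure" where
  "exp1 \<equiv> density lborel (\<lambda>x. ennreal (exponential_density 1 x))"

definition clock :: "(bool \<times> real) measure" where
  "clock = pair_measure (measure_pmf (bernoulli_pmf (1/2))) exp1"

lemma btm_noise_eq: "btm_noise = PiM UNIV (\<lambda>_. clock)"
  by (simp add: btm_noise_def clock_def)

interpretation exp1: prob_space exp1
  by (rule prob_space_exponential_density) simp

lemma sets_clock [measurable_cong]: "sets clock = sets (count_space UNIV \<Otimes>\<^sub>M borel)"
  unfolding clock_def by (intro sets_pair_measure_cong) auto

lemma space_clock [simp]: "space clock = UNIV"
  by (simp add: clock_def space_pair_measure)

lemma space_btm_noise [simp]: "space btm_noise = UNIV"
  by (simp add: btm_noise_eq space_PiM)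

lemma sets_btm_noise [measurable_cong]:
  "sets btm_noise = sets (PiM UNIV (\<lambda>_. count_space UNIV \<Otimes>\<^sub>M borel))"
  unfolding btm_noise_eq by (intro sets_PiM_cong) (auto simp: sets_clock)

interpretation clock: prob_space clock
proof -
  interpret pair_prob_space "measure_pmf (bernoulli_pmf (1/2))" exp1 ..
  show "prob_space clock" unfolding clock_def by (rule prob_space_axioms)
qed

interpretation noise: sequence_space clock ..

lemma prob_space_btm_noise: "prob_space btm_noise"
  unfolding btm_noise_eq by (rule noise.P.prob_space_axioms)

lemma nn_integral_clock:
  assumes [measurable]: "F \<in> borel_measurable (count_space UNIV \<Otimes>\<^sub>M borel)"
  shows "(\<integral>\<^sup>+x. F x \<partial>clock) =
    ((\<integral>\<^sup>+e. F (True, e) \<partial>exp1) + (\<integral>\<^sup>+e. F (False, e) \<partial>exp1)) / 2"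
proof -
  have half: "ennreal (1/2) = 1 / 2"
    by (metis divide_ennreal ennreal_1 ennreal_numeral zero_le_numeral zero_less_numeral zero_le_one)
  have "(\<integral>\<^sup>+x. F x \<partial>clock) =
      (\<integral>\<^sup>+c. (\<integral>\<^sup>+e. F (c, e) \<partial>exp1) \<partial>measure_pmf (bernoulli_pmf (1/2)))"
    unfolding clock_def
    by (intro exp1.nn_integral_fst[symmetric]) measurable
  also have "\<dots> = ((\<integral>\<^sup>+e. F (True, e) \<partial>exp1) + (\<integral>\<^sup>+e. F (False, e) \<partial>exp1)) / 2"
    by (subst nn_integral_bernoulli_pmf)
       (auto simp: half divide_ennreal_def distrib_right)
  finally show ?thesis .
qed

lemma nn_integral_clock_fst:
  "(\<integral>\<^sup>+x. F (fst x) \<partial>clock) = (F True + F False :: ennreal) / 2"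
  by (subst nn_integral_clock) (auto simp: exp1.emeasure_space_1[simplified])

lemma nn_integral_clock_snd:
  assumes [measurable]: "F \<in> borel_measurable borel"
  shows "(\<integral>\<^sup>+x. F (snd x) \<partial>clock) = (\<integral>\<^sup>+e. F e \<partial>exp1)"
proof -
  have "(\<integral>\<^sup>+x. F (snd x) \<partial>clock) = ((\<integral>\<^sup>+e. F e \<partial>exp1) * 2) / 2"
    by (subst nn_integral_clock) (auto simp: mult_2_right)
  then show ?thesis by (subst (asm) ennreal_mult_divide_eq) auto
qed

text \<open>The exponential density vanishes on the negative axis. Estimates that compare times
  before and after a jump use this sign, so they hold only almost everywhere.\<close>

lemma AE_clock_pos: "AE x in clock. 0 \<le> snd x"
proof -
  have "AE e in exp1. 0 \<le> e"
    by (auto simp: AE_density exponential_density_def)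
  then have "(\<integral>\<^sup>+e. (if 0 \<le> e then 0 else 1) \<partial>exp1) = 0"
    by (subst nn_integral_0_iff_AE) auto
  then have "(\<integral>\<^sup>+x. (if 0 \<le> snd x then 0 else 1) \<partial>clock) = 0"
    by (subst nn_integral_clock_snd) auto
  then show ?thesis
    by (subst (asm) nn_integral_0_iff_AE) (auto elim: eventually_mono split: if_splits)
qed

lemma nn_integral_exp1:
  assumes [measurable]: "F \<in> borel_measurable borel"
  shows "(\<integral>\<^sup>+e. F e \<partial>exp1) = (\<integral>\<^sup>+e. ennreal (exp (-e)) * indicator {0..} e * F e \<partial>lborel)"
  by (subst nn_integral_density)
     (auto simp: exponential_density_def intro!: nn_integral_cong split: split_indicator)

lemma nn_integral_exp1_id: "(\<integral>\<^sup>+e. ennreal e \<partial>exp1) = 1"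
proof -
  \<comment> \<open>The unit exponential law is the Erlang law with index 0, so this is its first
    moment.\<close>
  have "(\<integral>\<^sup>+e. ennreal e \<partial>exp1) =
      (\<integral>\<^sup>+e. ennreal (erlang_density 0 1 e * e ^ 1) \<partial>lborel)"
    by (subst nn_integral_density)
       (auto intro!: nn_integral_cong simp: ennreal_mult' exponential_density_def)
  also have "\<dots> = 1"
    by (subst nn_integral_erlang_ith_moment) auto
  finally show ?thesis .
qed

text \<open>The jump-counting error is discounted by exactly this factor at each step.\<close>
lemma nn_integral_exp1_exp:
  assumes "0 < l"
  shows "(\<integral>\<^sup>+e. ennreal (exp (- (e / l))) \<partial>exp1) = ennreal (l / (1 + l))"
proof -
  \<comment> \<open>The integrand times \<open>exp (- e)\<close> is \<open>l / (1 + l)\<close> times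
    the exponential density of rate \<open>(1 + l) / l\<close>, which has mass 1.\<close>
  have "(\<integral>\<^sup>+e. ennreal (exp (- (e / l))) \<partial>exp1) =
      (\<integral>\<^sup>+e. ennreal (l / (1 + l)) * ennreal (exponential_density ((1 + l) / l) e) \<partial>lborel)"
    proof (subst nn_integral_density, goal_cases)
    case 3
    have "exp (- e) * exp (- (e / l)) = exp (- (e * ((1 + l) / l)))" for e
      using assms by (simp add: mult_exp_exp field_simps)
    then show ?case using assms
      by (auto intro!: nn_integral_cong
         simp: ennreal_mult'[symmetric] exponential_density_def)
  qed auto
  also have "\<dots> = ennreal (l / (1 + l))"
  proof -
    have "0 < (1 + l) / l" using assms by simp
    from prob_space.emeasure_space_1[OF prob_space_exponential_density[OF this]]
    show ?thesis by (subst nn_integral_cmult) (auto simp: emeasure_density)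
  qed
  finally show ?thesis .
qed

section \<open>First-jump decomposition\<close>

definition btm_step :: "nat \<Rightarrow> bool \<Rightarrow> nat" where
  "btm_step y c = (if y = 0 then 1 else if c then y + 1 else y - 1)"

text \<open>The chain started from \<open>y\<close> is at \<open>z\<close> at time \<open>t\<close> after fewer than \<open>n\<close> jumps. The comparisons
  with \<open>t\<close> are those of \<open>btm_pos\<close>, so nothing is assumed about the sign of the holding times.\<close>
primrec at_site :: "(nat \<Rightarrow> real) \<Rightarrow> nat \<Rightarrow> nat \<Rightarrow> real \<Rightarrow> nat \<Rightarrow> (nat \<Rightarrow> bool \<times> real) \<Rightarrow> bool" where
  "at_site s z 0 t y \<omega> = False"
| "at_site s z (Suc n) t y \<omega> =
    (if t < snd (\<omega> 0) / btm_rate s y then y = z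
     else at_site s z n (t - snd (\<omega> 0) / btm_rate s y) (btm_step y (fst (\<omega> 0))) (\<lambda>i. \<omega> (Suc i)))"

text \<open>Stated from an arbitrary jump index \<open>j\<close>, so that the induction on
  \<open>n\<close> moves time, site and noise together. Jump times need not be monotone when holding
  times may be negative; the middle conjunct supplies the minimality that \<open>LEAST\<close> asks
  for.\<close>

lemma at_site_from_jump:
  assumes "at_site s z n (t - btm_jump_time s \<omega> j) (btm_walk \<omega> j) (\<lambda>i. \<omega> (j + i))"
  shows "\<exists>k\<ge>j. t < btm_jump_time s \<omega> (Suc k) \<and>
    (\<forall>i. j \<le> i \<and> i < k \<longrightarrow> \<not> t < btm_jump_time s \<omega> (Suc i)) \<and> btm_walk \<omega> k = z"
  using assms
proof (induction n arbitrary: j)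
  case (Suc n)
  let ?J = "btm_jump_time s \<omega>"
  have J: "?J (Suc j) = ?J j + snd (\<omega> j) / btm_rate s (btm_walk \<omega> j)"
    by (simp add: btm_jump_time_def)
  have W: "btm_walk \<omega> (Suc j) = btm_step (btm_walk \<omega> j) (fst (\<omega> j))"
    by (simp add: btm_step_def)
  show ?case
  proof (cases "t < ?J (Suc j)")
    case True
    then have "btm_walk \<omega> j = z"
      using Suc.prems J by (simp split: if_splits)
    with True show ?thesis by (intro exI[of _ j]) auto
  next
    case False
    then have "at_site s z n (t - ?J (Suc j)) (btm_walk \<omega> (Suc j)) (\<lambda>i. \<omega> (Suc j + i))"
      using Suc.prems J by (simp add: W algebra_simps del: btm_walk.simps split: if_splits)
    from Suc.IH[OF this] obtain k where k: "Suc j \<le> k" "t < ?J (Suc k)" "btm_walk \<omega> k = z"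
      "\<And>i. Suc j \<le> i \<Longrightarrow> i < k \<Longrightarrow> \<not> t < ?J (Suc i)" by blast
    have "\<not> t < ?J (Suc i)" if "j \<le> i" "i < k" for i
      using that False k(4)[of i] by (cases "i = j") auto
    with k show ?thesis by (intro exI[of _ k]) auto
  qed
qed simp

lemma btm_pos_at_site:
  assumes "at_site s z n t 0 \<omega>"
  shows "btm_pos s \<omega> t = z"
proof -
  have "at_site s z n (t - btm_jump_time s \<omega> 0) (btm_walk \<omega> 0) (\<lambda>i. \<omega> (0 + i))"
    using assms by (simp add: btm_jump_time_def)
  from at_site_from_jump[OF this] obtain k where
    k: "t < btm_jump_time s \<omega> (Suc k)" "btm_walk \<omega> k = z"
      "\<And>i. i < k \<Longrightarrow> \<not> t < btm_jump_time s \<omega> (Suc i)" by auto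
  then have "(LEAST n. t < btm_jump_time s \<omega> (Suc n)) = k"
    by (intro Least_equality) (auto simp: not_less[symmetric])
  with k show ?thesis by (auto simp: btm_pos_def)
qed

text \<open>After splitting on the coin, the site arguments no longer depend on the noise, so
  measurability at fixed sites suffices.\<close>

lemma at_site_step:
  "at_site s z n t (btm_step y c) \<omega> \<longleftrightarrow>
    (c \<and> at_site s z n t (btm_step y True) \<omega>) \<or> (\<not> c \<and> at_site s z n t (btm_step y False) \<omega>)"
  by (cases c) auto

text \<open>Joint in time and noise, because the recursion shifts the time by a random holding
  time.\<close>

lemma measurable_at_site_aux:
  "Measurable.pred (borel \<Otimes>\<^sub>M btm_noise) (\<lambda>p. at_site s z n (fst p) y (snd p))"
proof (induction n arbitrary: y)
  case (Suc n)
  have "(\<lambda>p. (fst p - snd (snd p 0) / btm_rate s y, \<lambda>i. snd p (Suc i)))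
      \<in> borel \<Otimes>\<^sub>M btm_noise \<rightarrow>\<^sub>M borel \<Otimes>\<^sub>M btm_noise"
    unfolding btm_noise_eq
    by (intro measurable_Pair measurable_PiM_single') (auto simp: space_pair_measure)
  then have [measurable]: "Measurable.pred (borel \<Otimes>\<^sub>M btm_noise) (\<lambda>p.
      at_site s z n (fst p - snd (snd p 0) / btm_rate s y) y' (\<lambda>i. snd p (Suc i)))" for y'
    using measurable_compose[OF _ Suc.IH[of y'], of "\<lambda>p. (fst p - snd (snd p 0) / btm_rate s y, \<lambda>i. snd p (Suc i))"] by simp
  show ?case
    by (simp only: at_site.simps, subst at_site_step) measurable
qed simp

lemma measurable_at_site [measurable (raw)]:
  assumes [measurable]: "T \<in> borel_measurable N" "W \<in> measurable N btm_noise"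
  shows "Measurable.pred N (\<lambda>x. at_site s z n (T x) y (W x))"
  using measurable_compose[OF measurable_Pair[OF assms] measurable_at_site_aux] by simp

text \<open>A path with \<open>n\<close> or more jumps by time \<open>t\<close> counts as a miss, so
  every \<open>n\<close> gives an upper bound for the quenched probability of being
  elsewhere.\<close>

definition miss_prob :: "(nat \<Rightarrow> real) \<Rightarrow> nat \<Rightarrow> nat \<Rightarrow> real \<Rightarrow> nat \<Rightarrow> ennreal" where
  "miss_prob s z n t y = (\<integral>\<^sup>+\<omega>. (if at_site s z n t y \<omega> then 0 else 1) \<partial>btm_noise)"

lemma measurable_miss_prob [measurable]: "(\<lambda>t. miss_prob s z n t y) \<in> borel_measurable borel"
proof -
  interpret B: prob_space btm_noise by (rule prob_space_btm_noise)
  show ?thesis unfolding miss_prob_def by measurable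
qed

lemma miss_prob_0: "miss_prob s z 0 t y = 1"
  using prob_space.emeasure_space_1[OF prob_space_btm_noise] by (simp add: miss_prob_def)

lemma miss_prob_le_1: "miss_prob s z n t y \<le> 1"
proof -
  have "miss_prob s z n t y \<le> (\<integral>\<^sup>+\<omega>. 1 \<partial>btm_noise)"
    unfolding miss_prob_def by (intro nn_integral_mono) auto
  also have "\<dots> = 1" using prob_space.emeasure_space_1[OF prob_space_btm_noise] by simp
  finally show ?thesis .
qed

text \<open>An i.i.d. sequence is an independent first entry followed by a sequence of the same law;
  Tonelli then integrates out the later noise with the first clock fixed.\<close>

lemma miss_prob_Suc:
  "miss_prob s z (Suc n) t y = (\<integral>\<^sup>+x. (if t < snd x / btm_rate s y then (if y = z then 0 else 1)
      else miss_prob s z n (t - snd x / btm_rate s y) (btm_step y (fst x))) \<partial>clock)"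
proof -
  interpret B: prob_space btm_noise by (rule prob_space_btm_noise)
  have [measurable]: "(\<lambda>(x, \<omega>). case_nat x \<omega>) \<in> clock \<Otimes>\<^sub>M btm_noise \<rightarrow>\<^sub>M btm_noise"
    unfolding btm_noise_eq by measurable
  let ?F = "\<lambda>\<omega>. if at_site s z (Suc n) t y \<omega> then 0 else 1 :: ennreal"
  have [measurable]: "?F \<in> borel_measurable btm_noise" by measurable
  have "miss_prob s z (Suc n) t y =
      (\<integral>\<^sup>+\<omega>. ?F \<omega> \<partial>distr (clock \<Otimes>\<^sub>M btm_noise) btm_noise (\<lambda>(x, \<omega>). case_nat x \<omega>))"
    using noise.PiM_iter by (simp add: miss_prob_def btm_noise_eq)
  also have "\<dots> = (\<integral>\<^sup>+p. ?F (case p of (x, \<omega>) \<Rightarrow> case_nat x \<omega>) \<partial>(clock \<Otimes>\<^sub>M btm_noise))"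
    by (rule nn_integral_distr) measurable
  also have "\<dots> = (\<integral>\<^sup>+x. \<integral>\<^sup>+\<omega>. ?F (case_nat x \<omega>) \<partial>btm_noise \<partial>clock)"
  proof -
    have "(\<lambda>p. ?F (case p of (x, \<omega>) \<Rightarrow> case_nat x \<omega>)) \<in> borel_measurable (clock \<Otimes>\<^sub>M btm_noise)"
      by (rule measurable_compose[of _ _ btm_noise]) measurable
    from B.nn_integral_fst[OF this] show ?thesis by (simp only: prod.case)
  qed
  also have "\<dots> = (\<integral>\<^sup>+x. (if t < snd x / btm_rate s y then (if y = z then 0 else 1)
      else miss_prob s z n (t - snd x / btm_rate s y) (btm_step y (fst x))) \<partial>clock)"
    using B.emeasure_space_1
    by (intro nn_integral_cong) (auto simp: miss_prob_def)
  finally show ?thesis .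
qed

lemma quenched_prob_ge:
  assumes "{\<omega>. btm_pos s \<omega> t = z} \<in> sets btm_noise"
  shows "ennreal (1 - quenched_prob s t z) \<le> miss_prob s z n t 0"
proof -
  interpret B: prob_space btm_noise by (rule prob_space_btm_noise)
  have "1 - quenched_prob s t z = measure btm_noise (UNIV - {\<omega>. btm_pos s \<omega> t = z})"
    using assms B.prob_compl[of "{\<omega>. btm_pos s \<omega> t = z}"] by (simp add: quenched_prob_def)
  then have "ennreal (1 - quenched_prob s t z) = emeasure btm_noise (UNIV - {\<omega>. btm_pos s \<omega> t = z})"
    by (simp add: B.emeasure_eq_measure)
  also have "\<dots> = (\<integral>\<^sup>+\<omega>. indicator (UNIV - {\<omega>. btm_pos s \<omega> t = z}) \<omega> \<partial>btm_noise)"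
    using assms sets.compl_sets[OF assms] by (subst nn_integral_indicator) auto
  also have "\<dots> \<le> miss_prob s z n t 0"
    unfolding miss_prob_def
    by (intro nn_integral_mono) (auto split: split_indicator dest: btm_pos_at_site)
  finally show ?thesis .
qed

lemma quenched_prob_le_1: "quenched_prob s t z \<le> 1"
  unfolding quenched_prob_def by (rule prob_space.prob_le_1[OF prob_space_btm_noise])

section \<open>Measurability of the position in the noise and the landscape\<close>

lemma measurable_btm_walk [measurable]: "(\<lambda>\<omega>. btm_walk \<omega> n) \<in> measurable btm_noise (count_space UNIV)"
proof (induction n)
  case (Suc n)
  note [measurable] = Suc.IH
  show ?case unfolding btm_walk.simps by measurable
qed simp

lemma measurable_btm_pos:
  assumes [measurable]: "\<And>x. (\<lambda>\<omega>. \<sigma> \<omega> x) \<in> borel_measurable M"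
  shows "(\<lambda>p. btm_pos (\<sigma> (fst p)) (snd p) t) \<in> measurable (M \<Otimes>\<^sub>M btm_noise) (count_space UNIV)"
proof -
  have [measurable]: "(\<lambda>p. btm_rate (\<sigma> (fst p)) x) \<in> borel_measurable (M \<Otimes>\<^sub>M btm_noise)" for x
    unfolding btm_rate_def by measurable
  \<comment> \<open>The site after \<open>k\<close> jumps is random but takes countably many values,
    so the rates at fixed sites suffice.\<close>
  have [measurable]: "(\<lambda>p. btm_rate (\<sigma> (fst p)) (btm_walk (snd p) k)) \<in> borel_measurable (M \<Otimes>\<^sub>M btm_noise)" for k
    by (rule measurable_compose_countable) measurable
  have [measurable]: "(\<lambda>p. btm_jump_time (\<sigma> (fst p)) (snd p) n) \<in> borel_measurable (M \<Otimes>\<^sub>M btm_noise)" for n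
    unfolding btm_jump_time_def by measurable
  have [measurable]: "(\<lambda>p. LEAST n. t < btm_jump_time (\<sigma> (fst p)) (snd p) (Suc n))
      \<in> measurable (M \<Otimes>\<^sub>M btm_noise) (count_space UNIV)"
    by measurable
  have [measurable]: "(\<lambda>p. btm_walk (snd p) (LEAST n. t < btm_jump_time (\<sigma> (fst p)) (snd p) (Suc n)))
      \<in> measurable (M \<Otimes>\<^sub>M btm_noise) (count_space UNIV)"
    by (rule measurable_compose_countable) measurable
  show ?thesis
    unfolding btm_pos_def by measurable
qed

lemma sets_btm_pos: "{\<omega>. btm_pos s \<omega> t = z} \<in> sets btm_noise"
proof -
  have "(\<lambda>\<omega>. btm_pos s \<omega> t) \<in> measurable btm_noise (count_space UNIV)"
    \<comment> \<open>A deterministic landscape is treated as a random one over the one-point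
      space.\<close>
    using measurable_compose[OF _ measurable_btm_pos[of "\<lambda>_. s" "count_space UNIV :: unit measure" t], of "\<lambda>\<omega>. ((), \<omega>)" btm_noise]
    by simp
  from measurable_sets[OF this, of "{z}"] show ?thesis by (simp add: vimage_def)
qed

lemma measurable_quenched_prob:
  assumes [measurable]: "\<And>x. (\<lambda>\<omega>. \<sigma> \<omega> x) \<in> borel_measurable M"
    and Z [measurable]: "Z \<in> measurable M (count_space UNIV)"
  shows "(\<lambda>\<omega>. quenched_prob (\<sigma> \<omega>) t (Z \<omega>)) \<in> borel_measurable M"
proof (rule measurable_compose_countable[OF _ Z])
  fix z :: nat
  interpret B: prob_space btm_noise by (rule prob_space_btm_noise)
  note [measurable] = measurable_btm_pos[OF assms(1), where t = t]
  have "{p \<in> space (M \<Otimes>\<^sub>M btm_noise). btm_pos (\<sigma> (fst p)) (snd p) t = z} \<in> sets (M \<Otimes>\<^sub>M btm_noise)"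
    by measurable
  from B.measurable_emeasure_Pair[OF this]
  have "(\<lambda>\<omega>. emeasure btm_noise (Pair \<omega> -` {p \<in> space (M \<Otimes>\<^sub>M btm_noise). btm_pos (\<sigma> (fst p)) (snd p) t = z}))
      \<in> borel_measurable M" .
  then have "(\<lambda>\<omega>. enn2real (emeasure btm_noise (Pair \<omega> -` {p \<in> space (M \<Otimes>\<^sub>M btm_noise).
      btm_pos (\<sigma> (fst p)) (snd p) t = z}))) \<in> borel_measurable M" by measurable
  also have "?this \<longleftrightarrow> (\<lambda>\<omega>. quenched_prob (\<sigma> \<omega>) t z) \<in> borel_measurable M"
    by (intro measurable_cong)
       (auto simp: quenched_prob_def measure_def space_pair_measure vimage_def)
  finally show "(\<lambda>\<omega>. quenched_prob (\<sigma> \<omega>) t z) \<in> borel_measurable M" .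
qed

section \<open>The quenched bound\<close>

lemma ennreal_average: "0 \<le> a \<Longrightarrow> 0 \<le> b \<Longrightarrow> (ennreal a + ennreal b) / 2 = ennreal ((a + b) / 2)"
  using divide_ennreal[of "a + b" 2] by (simp add: ennreal_plus)

lemma measurable_site_fun:
  fixes F :: "real \<Rightarrow> nat \<Rightarrow> ennreal"
  assumes F: "\<And>y. (\<lambda>t. F t y) \<in> borel_measurable borel"
    and [measurable]: "T \<in> borel_measurable N" "Y \<in> measurable N (count_space UNIV)"
  shows "(\<lambda>x. F (T x) (Y x)) \<in> borel_measurable N"
  by (rule measurable_compose_countable[where f = "\<lambda>y x. F (T x) y"])
     (use measurable_compose[OF assms(2) F] in auto)

text \<open>Integrated form of \<open>E' = l a\<close> for \<open>E t = \<integral>\<^sub>0\<^sup>t l a\<close>, after one exponential waiting time.\<close>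
lemma exponential_renewal:
  fixes a :: "real \<Rightarrow> ennreal"
  assumes [measurable]: "a \<in> borel_measurable borel" and l: "0 < l" and t: "0 \<le> t"
  shows "(\<integral>\<^sup>+e. (if t < e / l then 0 else a (t - e / l) +
      (\<integral>\<^sup>+u. ennreal l * a u * indicator {0..t - e / l} u \<partial>lborel)) \<partial>exp1)
    = (\<integral>\<^sup>+u. ennreal l * a u * indicator {0..t} u \<partial>lborel)" (is "?L = ?R")
proof -
  let ?E = "\<lambda>w. \<integral>\<^sup>+u. ennreal l * a u * indicator {0..w} u \<partial>lborel"
  let ?k = "\<lambda>w. l * exp (- (l * (t - w)))"
  have E_eq: "?E w = (\<integral>\<^sup>+u. ennreal l * a u * (if 0 \<le> u \<and> u \<le> w then 1 else 0) \<partial>lborel)" for w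
    by (intro nn_integral_cong) (auto split: split_indicator)
  have [measurable]: "?E \<in> borel_measurable borel"
    unfolding E_eq by measurable
  have "?L = (\<integral>\<^sup>+e. ennreal (exp (-e)) * indicator {0..} e *
      (if t < e / l then 0 else a (t - e / l) + ?E (t - e / l)) \<partial>lborel)"
    by (rule nn_integral_exp1) measurable
  \<comment> \<open>Substitution \<open>w = t - e / l\<close>, the time left after the wait; the
    exponential law becomes the kernel \<open>?k\<close> on \<open>{0..t}\<close>.\<close>
  also have "\<dots> = ennreal \<bar>- l\<bar> * (\<integral>\<^sup>+w. ennreal (exp (- (l * t + (- l) * w))) * indicator {0..} (l * t + (- l) * w) *
      (if t < (l * t + (- l) * w) / l then 0 else a (t - (l * t + (- l) * w) / l)
        + ?E (t - (l * t + (- l) * w) / l)) \<partial>lborel)"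
    using l by (intro nn_integral_real_affine) measurable
  also have "\<dots> = ennreal l * (\<integral>\<^sup>+w. ennreal (exp (- (l * (t - w)))) * indicator {0..t} w * (a w + ?E w) \<partial>lborel)"
  proof -
    have "(l * t + (- l) * w) / l = t - w" for w using l by (simp add: field_simps)
    moreover have "l * t + (- l) * w = l * (t - w)" for w by (simp add: algebra_simps)
    moreover have "(indicator {0..} (l * (t - w)) :: ennreal) * (if t < t - w then 0 else X) =
       indicator {0..t} w * X" for w X
      using l by (auto split: split_indicator simp: zero_le_mult_iff)
    ultimately show ?thesis
      using l by (auto intro!: nn_integral_cong arg_cong[where f = "\<lambda>x. ennreal l * x"] simp: mult.assoc)
  qed
  also have "\<dots> = (\<integral>\<^sup>+w. ennreal (?k w) * indicator {0..t} w * (a w + ?E w) \<partial>lborel)"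
  proof -
    have "(\<lambda>w. ennreal (exp (- (l * (t - w)))) * indicator {0..t} w * (a w + ?E w)) \<in> borel_measurable lborel"
      by measurable
    from nn_integral_cmult[OF this, of "ennreal l"] show ?thesis
      using l by (simp add: ennreal_mult' mult.assoc)
  qed
  also have "\<dots> = (\<integral>\<^sup>+w. ennreal (?k w) * indicator {0..t} w * a w \<partial>lborel) +
      (\<integral>\<^sup>+w. ennreal (?k w) * indicator {0..t} w * ?E w \<partial>lborel)"
    by (subst nn_integral_add[symmetric]) (auto intro!: nn_integral_cong simp: distrib_left)
  also have "(\<integral>\<^sup>+w. ennreal (?k w) * indicator {0..t} w * ?E w \<partial>lborel) =
     (\<integral>\<^sup>+w. (\<integral>\<^sup>+u. ennreal (?k w) * (if 0 \<le> w \<and> w \<le> t then 1 else 0) *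
        (ennreal l * a u * (if 0 \<le> u \<and> u \<le> w then 1 else 0)) \<partial>lborel) \<partial>lborel)"
    unfolding E_eq
    by (intro nn_integral_cong, subst nn_integral_cmult) (auto split: split_indicator)
  \<comment> \<open>With the integrals exchanged, \<open>?k\<close> is integrated over
    \<open>{u..t}\<close>, giving \<open>1 - exp (- (l * (t - u)))\<close>. This complements the
    weight of \<open>a u\<close> in the other summand, and the total weight is
    \<open>l\<close>.\<close>
  also have "\<dots> = (\<integral>\<^sup>+u. (\<integral>\<^sup>+w. ennreal (?k w) * (if 0 \<le> w \<and> w \<le> t then 1 else 0) *
        (ennreal l * a u * (if 0 \<le> u \<and> u \<le> w then 1 else 0)) \<partial>lborel) \<partial>lborel)"
    by (rule lborel_pair.Fubini'[symmetric]) measurable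
  also have "\<dots> = (\<integral>\<^sup>+u. ennreal l * a u * indicator {0..t} u * ennreal (1 - exp (- (l * (t - u)))) \<partial>lborel)"
  proof (intro nn_integral_cong)
    fix u
    have "(\<integral>\<^sup>+w. ennreal (?k w) * (if 0 \<le> w \<and> w \<le> t then 1 else 0) *
        (ennreal l * a u * (if 0 \<le> u \<and> u \<le> w then 1 else 0)) \<partial>lborel) =
      (\<integral>\<^sup>+w. (ennreal l * a u * indicator {0..t} u) * (ennreal (?k w) * indicator {u..t} w) \<partial>lborel)"
      by (intro nn_integral_cong) (auto split: split_indicator simp: mult_ac)
    also have "\<dots> = (ennreal l * a u * indicator {0..t} u) * (\<integral>\<^sup>+w. ennreal (?k w) * indicator {u..t} w \<partial>lborel)"
      by (rule nn_integral_cmult) measurable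
    also have "\<dots> = ennreal l * a u * indicator {0..t} u * ennreal (1 - exp (- (l * (t - u))))"
    proof (cases "u \<le> t")
      case True
      have "(\<integral>\<^sup>+w. ennreal (?k w) * indicator {u..t} w \<partial>lborel) =
          ennreal (exp (- (l * (t - t))) - exp (- (l * (t - u))))"
        using l True
        by (intro nn_integral_FTC_Icc) (auto intro!: derivative_eq_intros)
      then show ?thesis by simp
    qed (auto split: split_indicator)
    finally show "(\<integral>\<^sup>+w. ennreal (?k w) * (if 0 \<le> w \<and> w \<le> t then 1 else 0) *
        (ennreal l * a u * (if 0 \<le> u \<and> u \<le> w then 1 else 0)) \<partial>lborel) =
        ennreal l * a u * indicator {0..t} u * ennreal (1 - exp (- (l * (t - u))))" .
  qed
  also have "(\<integral>\<^sup>+w. ennreal (?k w) * indicator {0..t} w * a w \<partial>lborel) + \<dots> =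
      (\<integral>\<^sup>+u. ennreal (?k u) * indicator {0..t} u * a u
        + ennreal l * a u * indicator {0..t} u * ennreal (1 - exp (- (l * (t - u)))) \<partial>lborel)"
    by (rule nn_integral_add[symmetric]) measurable
  also have "\<dots> = ?R"
  proof (intro nn_integral_cong)
    fix u
    show "ennreal (?k u) * indicator {0..t} u * a u
        + ennreal l * a u * indicator {0..t} u * ennreal (1 - exp (- (l * (t - u)))) =
        ennreal l * a u * indicator {0..t} u"
    proof (cases "u \<in> {0..t}")
      case True
      then have "ennreal (?k u) * a u + ennreal l * a u * ennreal (1 - exp (- (l * (t - u)))) =
        (ennreal (exp (- (l * (t - u)))) + ennreal (1 - exp (- (l * (t - u))))) * (ennreal l * a u)"
        using l by (simp add: ennreal_mult' distrib_left distrib_right mult_ac)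
      also have "ennreal (exp (- (l * (t - u)))) + ennreal (1 - exp (- (l * (t - u)))) = 1"
        using l True by (subst ennreal_plus[symmetric]) auto
      finally show ?thesis using True by simp
    qed auto
  qed
  finally show ?thesis .
qed

section \<open>Hitting, excursions and escape around one trap\<close>

locale trap_window =
  fixes s :: "nat \<Rightarrow> real" and z r :: nat
  assumes pos: "\<And>x. 0 < s x" and r: "1 \<le> r"
begin

lemma rate_pos: "0 < btm_rate s y"
  using pos[of 0] pos[of y] by (simp add: btm_rate_def)

text \<open>Probability that the chain from \<open>y\<close> stays off \<open>z\<close> and below \<open>z + r\<close> up to time \<open>t\<close>, up to
  the event of \<open>n\<close> or more jumps.\<close>
primrec late :: "nat \<Rightarrow> real \<Rightarrow> nat \<Rightarrow> ennreal" where
  "late 0 t y = 0"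
| "late (Suc n) t y = (if y = z \<or> z + r \<le> y then 0
     else \<integral>\<^sup>+x. (if t < snd x / btm_rate s y then 1
            else late n (t - snd x / btm_rate s y) (btm_step y (fst x))) \<partial>clock)"

lemma measurable_late: "(\<lambda>t. late n t y) \<in> borel_measurable borel"
proof (induction n arbitrary: y)
  case (Suc n)
  have [measurable]: "(\<lambda>p. late n (fst p - snd (snd p) / btm_rate s y) (btm_step y (fst (snd p))))
      \<in> borel_measurable (borel \<Otimes>\<^sub>M clock)"
    by (rule measurable_site_fun[OF Suc.IH]) measurable
  show ?case by (simp add: split_beta')
qed simp

lemma measurable_late' [measurable (raw)]:
  assumes "T \<in> borel_measurable N" "Y \<in> measurable N (count_space UNIV)"
  shows "(\<lambda>x. late n (T x) (Y x)) \<in> borel_measurable N"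
  by (rule measurable_site_fun[OF measurable_late assms])

lemma late_le_1: "late n t y \<le> 1"
proof (induction n arbitrary: t y)
  case (Suc n)
  have "(\<integral>\<^sup>+x. (if t < snd x / btm_rate s y then 1
      else late n (t - snd x / btm_rate s y) (btm_step y (fst x))) \<partial>clock) \<le> (\<integral>\<^sup>+x. 1 \<partial>clock)"
    by (intro nn_integral_mono) (auto simp: Suc.IH)
  then show ?case using clock.emeasure_space_1 by simp
qed simp

text \<open>The two sides are compared clock by clock; if the first jump falls between
  \<open>t\<close> and \<open>t'\<close>, then \<open>late_le_1\<close> decides. This feeds Markov's
  inequality in \<open>late_le\<close>.\<close>

lemma late_antimono: "t \<le> t' \<Longrightarrow> late n t' y \<le> late n t y"
proof (induction n arbitrary: t t' y)
  case (Suc n)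
  have "(if t' < h then 1 else late n (t' - h) y') \<le> (if t < h then 1 else late n (t - h) y')" for h y'
    using Suc.prems Suc.IH[of "t - h" "t' - h"] late_le_1 by auto
  then show ?case by (auto intro!: nn_integral_mono)
qed simp

lemma late_mono: "late n t y \<le> late (Suc n) t y"
proof (induction n arbitrary: t y)
  case (Suc n)
  show ?case
    by (subst (1 2) late.simps) (auto simp del: late.simps intro!: nn_integral_mono Suc.IH)
qed simp

text \<open>Mean exit time from the component of \<open>y\<close> in \<open>{0..<z + r} - {z}\<close>, with reflection at
  \<open>z + r - 1\<close>: depth times twice the distance (the effective resistance to \<open>z\<close>). The truncated
  subtractions make each sum vanish when \<open>y\<close> lies on the other side of \<open>z\<close>.\<close>
definition green :: "nat \<Rightarrow> real" where
  "green y = (\<Sum>u<z. 2 * s u * real (min (z - u) (z - y))) +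
     (\<Sum>u\<in>{z<..<z + r}. 2 * s u * real (min (u - z) (y - z)))"

lemma green_nonneg: "0 \<le> green y"
  unfolding green_def using pos by (intro add_nonneg_nonneg sum_nonneg) (simp_all add: less_imp_le)

text \<open>Poisson equation for the mean exit time. For each \<open>u\<close> the summand is affine
  in \<open>y\<close> apart from a kink at \<open>y = u\<close>, so averaging over the neighbours
  loses only the term of \<open>u = y\<close>, which is the mean holding time.\<close>

lemma green_step:
  assumes "y \<noteq> z" "y < z + r"
  shows "1 / btm_rate s y + (green (btm_step y True) + green (btm_step y False)) / 2 = green y"
proof (cases "y < z")
  case yz: True
  have R: "(\<Sum>u\<in>{z<..<z + r}. 2 * s u * real (min (u - z) (y' - z))) = 0" if "y' \<le> z" for y'
    using that by (intro sum.neutral) auto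
  show ?thesis
  proof (cases "y = 0")
    case True
    \<comment> \<open>From 0 both coins lead to 1, so the full slope is lost instead of half the
      kink: \<open>2 * s 0\<close> matches the halved rate at 0.\<close>
    have "2 * s u * real (min (z - u) (z - 0)) = 2 * s u * real (min (z - u) (z - 1)) + (if u = 0 then 2 * s u else 0)"
      if "u \<in> {..<z}" for u
      using that by (cases u) (auto simp: min_def of_nat_diff algebra_simps)
    then have "(\<Sum>u<z. 2 * s u * real (min (z - u) (z - 0))) =
       (\<Sum>u<z. 2 * s u * real (min (z - u) (z - 1)) + (if u = 0 then 2 * s u else 0))"
      by (intro sum.cong) auto
    also have "\<dots> = (\<Sum>u<z. 2 * s u * real (min (z - u) (z - 1))) + 2 * s 0"
      using yz True by (simp add: sum.distrib)
    finally show ?thesis using True yz R[of 0] R[of 1]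
      by (simp add: green_def btm_step_def btm_rate_def)
  next
    case False
    have "2 * s u * real (min (z - u) (z - y)) =
        (2 * s u * real (min (z - u) (z - (y + 1))) + 2 * s u * real (min (z - u) (z - (y - 1)))) / 2
          + (if u = y then s u else 0)"
      if "u \<in> {..<z}" for u
    proof -
      have "2 * real (min (z - u) (z - y)) = real (min (z - u) (z - (y + 1))) + real (min (z - u) (z - (y - 1)))
        + (if u = y then 1 else 0)"
        using that yz False by (auto simp: min_def of_nat_diff)
      then have "s u * (2 * real (min (z - u) (z - y))) = s u * (real (min (z - u) (z - (y + 1))) + real (min (z - u) (z - (y - 1)))
        + (if u = y then 1 else 0))" by simp
      then show ?thesis by (auto simp: algebra_simps)
    qed
    then have "(\<Sum>u<z. 2 * s u * real (min (z - u) (z - y))) =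
       (\<Sum>u<z. (2 * s u * real (min (z - u) (z - (y + 1))) + 2 * s u * real (min (z - u) (z - (y - 1)))) / 2
          + (if u = y then s u else 0))"
      by (intro sum.cong) auto
    also have "\<dots> = ((\<Sum>u<z. 2 * s u * real (min (z - u) (z - (y + 1)))) +
        (\<Sum>u<z. 2 * s u * real (min (z - u) (z - (y - 1))))) / 2 + s y"
      using yz by (simp add: sum.distrib sum_divide_distrib[symmetric])
    finally show ?thesis using False yz R[of y] R[of "y + 1"] R[of "y - 1"]
      by (simp add: green_def btm_step_def btm_rate_def)
  qed
next
  case False
  with assms have yz: "z < y" by simp
  have L: "(\<Sum>u<z. 2 * s u * real (min (z - u) (z - y'))) = 0" if "z \<le> y'" for y'
    using that by (intro sum.neutral) auto
  have "2 * s u * real (min (u - z) (y - z)) =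
      (2 * s u * real (min (u - z) (y + 1 - z)) + 2 * s u * real (min (u - z) (y - 1 - z))) / 2
        + (if u = y then s u else 0)"
    if "u \<in> {z<..<z + r}" for u
  proof -
    have "2 * real (min (u - z) (y - z)) = real (min (u - z) (y + 1 - z)) + real (min (u - z) (y - 1 - z))
      + (if u = y then 1 else 0)"
      using that yz by (auto simp: min_def of_nat_diff)
    then have "s u * (2 * real (min (u - z) (y - z))) = s u * (real (min (u - z) (y + 1 - z)) + real (min (u - z) (y - 1 - z))
      + (if u = y then 1 else 0))" by simp
    then show ?thesis by (auto simp: algebra_simps)
  qed
  then have "(\<Sum>u\<in>{z<..<z + r}. 2 * s u * real (min (u - z) (y - z))) =
     (\<Sum>u\<in>{z<..<z + r}. (2 * s u * real (min (u - z) (y + 1 - z)) + 2 * s u * real (min (u - z) (y - 1 - z))) / 2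
        + (if u = y then s u else 0))"
    by (intro sum.cong) auto
  also have "\<dots> = ((\<Sum>u\<in>{z<..<z + r}. 2 * s u * real (min (u - z) (y + 1 - z))) +
      (\<Sum>u\<in>{z<..<z + r}. 2 * s u * real (min (u - z) (y - 1 - z)))) / 2 + s y"
    using yz assms by (simp add: sum.distrib sum_divide_distrib[symmetric])
  finally show ?thesis using yz L[of y] L[of "y + 1"] L[of "y - 1"]
    by (simp add: green_def btm_step_def btm_rate_def)
qed

text \<open>The time integral of a survival probability is a mean duration. Conditioning on the
  first jump adds the mean holding time, and \<open>green_step\<close> closes the induction.\<close>

lemma late_integral: "(\<integral>\<^sup>+t. late n t y * indicator {0..} t \<partial>lborel) \<le> ennreal (green y)"
proof (induction n arbitrary: y)
  case (Suc n)
  show ?case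
  proof (cases "y = z \<or> z + r \<le> y")
    case False
    let ?l = "btm_rate s y"
    have "(\<integral>\<^sup>+t. late (Suc n) t y * indicator {0..} t \<partial>lborel) =
        (\<integral>\<^sup>+t. \<integral>\<^sup>+x. (if 0 \<le> t then (if t < snd x / ?l then 1
            else late n (t - snd x / ?l) (btm_step y (fst x))) else 0) \<partial>clock \<partial>lborel)"
      using False by (intro nn_integral_cong) (auto split: split_indicator)
    also have "\<dots> = (\<integral>\<^sup>+x. \<integral>\<^sup>+t. (if 0 \<le> t then (if t < snd x / ?l then 1
            else late n (t - snd x / ?l) (btm_step y (fst x))) else 0) \<partial>lborel \<partial>clock)"
    proof -
      interpret pair_sigma_finite clock lborel ..
      show ?thesis by (rule Fubini') measurable
    qed
    also have "\<dots> \<le> (\<integral>\<^sup>+x. ennreal (1 / ?l) * ennreal (snd x) + ennreal (green (btm_step y (fst x))) \<partial>clock)"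
    proof (rule nn_integral_mono_AE)
      show "AE x in clock. (\<integral>\<^sup>+t. (if 0 \<le> t then (if t < snd x / ?l then 1
            else late n (t - snd x / ?l) (btm_step y (fst x))) else 0) \<partial>lborel) \<le>
          ennreal (1 / ?l) * ennreal (snd x) + ennreal (green (btm_step y (fst x)))"
        using AE_clock_pos
      proof eventually_elim
        case (elim x)
        let ?h = "snd x / ?l" and ?y = "btm_step y (fst x)"
        have h: "0 \<le> ?h" using elim rate_pos[of y] by simp
        have "(\<integral>\<^sup>+t. (if 0 \<le> t then (if t < ?h then 1 else late n (t - ?h) ?y) else 0) \<partial>lborel) =
          (\<integral>\<^sup>+t. indicator {0..<?h} t + late n (t - ?h) ?y * indicator {0..} (t - ?h) \<partial>lborel)"
          using h by (intro nn_integral_cong) (auto split: split_indicator)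
        also have "\<dots> = (\<integral>\<^sup>+t. indicator {0..<?h} t \<partial>lborel) +
            (\<integral>\<^sup>+t. late n (t - ?h) ?y * indicator {0..} (t - ?h) \<partial>lborel)"
          by (rule nn_integral_add) measurable
        also have "(\<integral>\<^sup>+t. indicator {0..<?h} t \<partial>lborel) = ennreal ?h"
          using h by simp
        also have "(\<integral>\<^sup>+t. late n (t - ?h) ?y * indicator {0..} (t - ?h) \<partial>lborel) =
            (\<integral>\<^sup>+t. late n t ?y * indicator {0..} t \<partial>lborel)"
          by (subst nn_integral_real_affine[where c = 1 and t = ?h]) (auto simp: measurable_late)
        also have "ennreal ?h + \<dots> \<le> ennreal ?h + ennreal (green ?y)"
          using Suc.IH[of ?y] by (rule add_left_mono)
        also have "ennreal ?h = ennreal (1 / ?l) * ennreal (snd x)"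
          using elim rate_pos[of y] by (simp add: ennreal_mult'[symmetric])
        finally show ?case .
      qed
    qed
    also have "\<dots> = ennreal (1 / ?l) + (\<integral>\<^sup>+x. ennreal (green (btm_step y (fst x))) \<partial>clock)"
      by (subst nn_integral_add)
         (auto simp: nn_integral_cmult nn_integral_clock_snd nn_integral_exp1_id)
    also have "\<dots> = ennreal (1 / ?l + (green (btm_step y True) + green (btm_step y False)) / 2)"
      using rate_pos[of y] green_nonneg
      by (subst nn_integral_clock_fst) (simp add: ennreal_average ennreal_plus)
    also have "\<dots> = ennreal (green y)"
      using False by (subst green_step) auto
    finally show ?thesis .
  qed (use green_nonneg in auto)
qed simp

text \<open>Gambler's ruin probability of reaching \<open>z + r\<close> before \<open>z\<close>;
  truncated subtraction makes it 0 to the left of \<open>z\<close>.\<close>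

definition esc :: "nat \<Rightarrow> real" where
  "esc y = min 1 (real (y - z) / real r)"

lemma esc_nonneg: "0 \<le> esc y"
  by (simp add: esc_def)

text \<open>Linear between \<open>z\<close> and \<open>z + r\<close>, where capping a neighbour at 1
  can only lower the average; to the left of \<open>z\<close> all terms vanish.\<close>

lemma esc_step:
  assumes "y \<noteq> z" "y < z + r"
  shows "(esc (btm_step y True) + esc (btm_step y False)) / 2 \<le> esc y"
proof (cases "y < z")
  case True
  then show ?thesis by (auto simp: esc_def btm_step_def)
next
  case False
  then have yz: "z < y" "y \<noteq> 0" using assms by auto
  have "esc (btm_step y True) \<le> real (y + 1 - z) / r" "esc (btm_step y False) \<le> real (y - 1 - z) / r"
    using yz by (auto simp: esc_def btm_step_def)
  then have "(esc (btm_step y True) + esc (btm_step y False)) / 2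
      \<le> (real (y + 1 - z) / r + real (y - 1 - z) / r) / 2"
    by (intro divide_right_mono add_mono) auto
  also have "\<dots> = real (y - z) / r"
    using yz r by (simp add: of_nat_diff field_simps)
  also have "\<dots> = esc y"
    using r assms by (simp add: esc_def min_def)
  finally show ?thesis .
qed

text \<open>With departures from \<open>z\<close> at rate \<open>btm_rate s z\<close> throughout \<open>{0..t}\<close>, \<open>exc n t\<close> is the expected
  number of those that lead to an excursion in progress at time \<open>t\<close> or to a visit of \<open>z + r\<close>.\<close>
definition drift :: "nat \<Rightarrow> real \<Rightarrow> ennreal" where
  "drift n u = (\<integral>\<^sup>+x. late n u (btm_step z (fst x)) + ennreal (esc (btm_step z (fst x))) \<partial>clock)"

definition exc :: "nat \<Rightarrow> real \<Rightarrow> ennreal" where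
  "exc n t = (\<integral>\<^sup>+u. ennreal (btm_rate s z) * drift n u * indicator {0..t} u \<partial>lborel)"

lemma measurable_drift [measurable]: "drift n \<in> borel_measurable borel"
  unfolding drift_def by measurable

lemma measurable_exc [measurable]: "exc n \<in> borel_measurable borel"
proof -
  have "exc n = (\<lambda>t. \<integral>\<^sup>+u. ennreal (btm_rate s z) * drift n u * (if 0 \<le> u \<and> u \<le> t then 1 else 0) \<partial>lborel)"
    unfolding exc_def by (intro ext nn_integral_cong) (auto split: split_indicator)
  also have "\<dots> \<in> borel_measurable borel" by measurable
  finally show ?thesis .
qed

lemma exc_mono: "t \<le> t' \<Longrightarrow> exc n t \<le> exc n t'"
  unfolding exc_def by (intro nn_integral_mono mult_left_mono) (auto split: split_indicator)

lemma drift_Suc: "drift n u \<le> drift (Suc n) u"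
  unfolding drift_def by (intro nn_integral_mono add_right_mono late_mono)

lemma exc_Suc: "exc n t \<le> exc (Suc n) t"
  unfolding exc_def by (intro nn_integral_mono mult_right_mono mult_left_mono drift_Suc) auto

lemma drift_eq:
  "drift n u = ((late n u (btm_step z True) + ennreal (esc (btm_step z True))) +
     (late n u (btm_step z False) + ennreal (esc (btm_step z False)))) / 2"
  unfolding drift_def by (rule nn_integral_clock_fst)

text \<open>Averaging over the coin turns the excursion terms into \<open>drift n\<close>; the rest
  is \<open>exponential_renewal\<close> with \<open>a = drift n\<close>.\<close>

lemma exc_step:
  assumes t: "0 \<le> t"
  shows "(\<integral>\<^sup>+x. (if t < snd x / btm_rate s z then 0
      else late n (t - snd x / btm_rate s z) (btm_step z (fst x)) + ennreal (esc (btm_step z (fst x)))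
        + exc n (t - snd x / btm_rate s z)) \<partial>clock) = exc n t" (is "?L = _")
proof -
  let ?l = "btm_rate s z"
  let ?F = "\<lambda>c e. if t < e / ?l then 0
      else late n (t - e / ?l) (btm_step z c) + ennreal (esc (btm_step z c)) + exc n (t - e / ?l)"
  note [measurable] = measurable_late
  have "?L = ((\<integral>\<^sup>+e. ?F True e \<partial>exp1) + (\<integral>\<^sup>+e. ?F False e \<partial>exp1)) / 2"
    by (subst nn_integral_clock, measurable, simp only: fst_conv snd_conv)
  also have "\<dots> = (\<integral>\<^sup>+e. (?F True e + ?F False e) / 2 \<partial>exp1)"
    by (subst nn_integral_divide, measurable, subst nn_integral_add, measurable)
  also have "\<dots> = (\<integral>\<^sup>+e. (if t < e / ?l then 0 else drift n (t - e / ?l) + exc n (t - e / ?l)) \<partial>exp1)"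
  proof (intro nn_integral_cong)
    fix e
    have half: "(X + X) / 2 = X" for X :: ennreal
      using ennreal_mult_divide_eq[of 2 X] by (simp add: mult_2_right)
    have "(a + b + x + (c + d + x)) / 2 = (a + b + (c + d)) / 2 + x" for a b c d x :: ennreal
    proof -
      have "a + b + x + (c + d + x) = (a + b + (c + d)) + (x + x)" by (simp add: add_ac)
      then show ?thesis using half[of x] by (simp only: add_divide_distrib_ennreal)
    qed
    then show "(?F True e + ?F False e) / 2 =
        (if t < e / ?l then 0 else drift n (t - e / ?l) + exc n (t - e / ?l))"
      by (auto simp: drift_eq)
  qed
  also have "\<dots> = exc n t"
    unfolding exc_def by (rule exponential_renewal) (use rate_pos t in auto)
  finally show ?thesis .
qed

text \<open>The Laplace transform of the holding time at 1 is
  \<open>btm_rate s y / (1 + btm_rate s y)\<close>, which pays for one more factor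
  \<open>th\<close>.\<close>

lemma clock_discount:
  assumes "btm_rate s y / (1 + btm_rate s y) \<le> th" "0 \<le> th"
  shows "(\<integral>\<^sup>+x. ennreal (th ^ n * exp t) * ennreal (exp (- (snd x / btm_rate s y))) \<partial>clock)
    \<le> ennreal (th ^ Suc n * exp t)"
proof -
  have "(\<integral>\<^sup>+x. ennreal (th ^ n * exp t) * ennreal (exp (- (snd x / btm_rate s y))) \<partial>clock) =
      ennreal (th ^ n * exp t) * ennreal (btm_rate s y / (1 + btm_rate s y))"
    using nn_integral_clock_snd[of "\<lambda>e. ennreal (exp (- (e / btm_rate s y)))"]
    by (subst nn_integral_cmult) (auto simp: nn_integral_exp1_exp rate_pos)
  also have "\<dots> \<le> ennreal (th ^ n * exp t) * ennreal th"
    using assms by (intro mult_left_mono ennreal_leI) auto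
  also have "\<dots> = ennreal (th ^ Suc n * exp t)"
    using assms by (simp add: ennreal_mult'[symmetric] mult_ac)
  finally show ?thesis .
qed

text \<open>Beyond the window \<open>esc\<close> alone is 1. At \<open>z\<close> the terms after a
  jump average to \<open>exc n t\<close>. Elsewhere \<open>late\<close> obeys its own recursion,
  \<open>exc\<close> only grows with time, and \<open>esc\<close> is superharmonic.\<close>

lemma miss_prob_le:
  assumes th: "\<And>y. y < z + r \<Longrightarrow> btm_rate s y / (1 + btm_rate s y) \<le> th" "0 \<le> th"
    and t: "0 \<le> t"
  shows "miss_prob s z n t y \<le> late n t y + exc n t + ennreal (esc y) + ennreal (th ^ n * exp t)"
  using t
proof (induction n arbitrary: t y)
  case 0
  \<comment> \<open>With no jump allowed, the error term \<open>exp t\<close> already exceeds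
    1.\<close>
  have "ennreal 1 \<le> ennreal (exp t)" using 0 by (intro ennreal_leI) simp
  then show ?case by (auto simp: miss_prob_0 intro: order_trans add_increasing)
next
  case (Suc n)
  let ?l = "btm_rate s y"
  let ?D = "\<lambda>x. ennreal (th ^ n * exp t) * ennreal (exp (- (snd x / ?l)))"
  have D: "ennreal (th ^ n * exp (t - snd x / ?l)) = ?D x" for x :: "bool \<times> real"
    using th(2) by (simp add: ennreal_mult'[symmetric] exp_diff exp_minus field_simps)
  consider "z + r \<le> y" | "y = z" | "y \<noteq> z" "y < z + r" by linarith
  then show ?case
  proof cases
    case 1
    have "miss_prob s z (Suc n) t y \<le> ennreal (esc y)"
      using 1 r miss_prob_le_1[of s z "Suc n" t y] by (simp add: esc_def min_def)
    then show ?thesis by (auto intro: order_trans add_increasing add_increasing2)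
  next
    case 2
    let ?E = "\<lambda>x. if t < snd x / ?l then 0
      else late n (t - snd x / ?l) (btm_step y (fst x)) + ennreal (esc (btm_step y (fst x)))
        + exc n (t - snd x / ?l)"
    \<comment> \<open>At \<open>z\<close> a wait beyond \<open>t\<close> is no miss; otherwise the
      induction hypothesis applies to the remaining time.\<close>
    have "miss_prob s z (Suc n) t y \<le> (\<integral>\<^sup>+x. ?E x + ?D x \<partial>clock)"
      unfolding miss_prob_Suc
    proof (intro nn_integral_mono)
      fix x :: "bool \<times> real"
      show "(if t < snd x / ?l then (if y = z then 0 else 1)
          else miss_prob s z n (t - snd x / ?l) (btm_step y (fst x))) \<le> ?E x + ?D x"
        using Suc.IH[of "t - snd x / ?l" "btm_step y (fst x)"] 2
        unfolding D[symmetric] by (auto simp: add_ac)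
    qed
    also have "\<dots> = (\<integral>\<^sup>+x. ?E x \<partial>clock) + (\<integral>\<^sup>+x. ?D x \<partial>clock)"
      by (rule nn_integral_add) measurable
    also have "\<dots> \<le> exc n t + ennreal (th ^ Suc n * exp t)"
    proof (rule add_mono)
      show "(\<integral>\<^sup>+x. ?E x \<partial>clock) \<le> exc n t"
        unfolding 2 using exc_step[OF Suc.prems, of n] by simp
      show "(\<integral>\<^sup>+x. ?D x \<partial>clock) \<le> ennreal (th ^ Suc n * exp t)"
        by (rule clock_discount) (use th 2 r in auto)
    qed
    also have "\<dots> \<le> late (Suc n) t y + exc (Suc n) t + ennreal (esc y) + ennreal (th ^ Suc n * exp t)"
      by (intro add_right_mono) (use exc_Suc[of n t] in \<open>auto intro: order_trans add_increasing add_increasing2\<close>)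
    finally show ?thesis .
  next
    case 3
    let ?E = "\<lambda>x. if t < snd x / ?l then 1 else late n (t - snd x / ?l) (btm_step y (fst x))"
    \<comment> \<open>Here \<open>exc\<close> at the remaining time is replaced by
      \<open>exc n t\<close>, which requires a nonnegative holding time.\<close>
    have "miss_prob s z (Suc n) t y \<le>
        (\<integral>\<^sup>+x. ?E x + (exc n t + (ennreal (esc (btm_step y (fst x))) + ?D x)) \<partial>clock)"
      unfolding miss_prob_Suc
    proof (rule nn_integral_mono_AE)
      show "AE x in clock. (if t < snd x / ?l then (if y = z then 0 else 1)
          else miss_prob s z n (t - snd x / ?l) (btm_step y (fst x)))
          \<le> ?E x + (exc n t + (ennreal (esc (btm_step y (fst x))) + ?D x))"
        using AE_clock_pos
      proof eventually_elim
        case (elim x)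
        show ?case
        proof (cases "t < snd x / ?l")
          case True
          then show ?thesis using 3 by (auto intro: add_increasing2)
        next
          case False
          let ?y = "btm_step y (fst x)" and ?t = "t - snd x / ?l"
          have "0 \<le> ?t" "?t \<le> t" using False elim rate_pos[of y] by auto
          then have "miss_prob s z n ?t ?y \<le> late n ?t ?y + (exc n ?t + (ennreal (esc ?y) + ennreal (th ^ n * exp ?t)))"
            using Suc.IH[of ?t ?y] by (simp add: add_ac)
          also have "\<dots> \<le> late n ?t ?y + (exc n t + (ennreal (esc ?y) + ennreal (th ^ n * exp ?t)))"
            using \<open>?t \<le> t\<close> by (intro add_left_mono add_right_mono exc_mono)
          finally show ?thesis using False 3 unfolding D by auto
        qed
      qed
    qed
    also have "\<dots> = (\<integral>\<^sup>+x. ?E x \<partial>clock) + ((\<integral>\<^sup>+x. exc n t \<partial>clock) +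
        ((\<integral>\<^sup>+x. ennreal (esc (btm_step y (fst x))) \<partial>clock) + (\<integral>\<^sup>+x. ?D x \<partial>clock)))"
      by (subst nn_integral_add, measurable, subst nn_integral_add, measurable,
          subst nn_integral_add, measurable)
    also have "(\<integral>\<^sup>+x. ?E x \<partial>clock) = late (Suc n) t y" using 3 by simp
    also have "(\<integral>\<^sup>+x. exc n t \<partial>clock) = exc n t"
      using clock.emeasure_space_1 by simp
    also have "late (Suc n) t y + (exc n t + ((\<integral>\<^sup>+x. ennreal (esc (btm_step y (fst x))) \<partial>clock) + (\<integral>\<^sup>+x. ?D x \<partial>clock)))
        \<le> late (Suc n) t y + (exc (Suc n) t + (ennreal (esc y) + ennreal (th ^ Suc n * exp t)))"
    proof (intro add_left_mono add_mono exc_Suc)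
      show "(\<integral>\<^sup>+x. ennreal (esc (btm_step y (fst x))) \<partial>clock) \<le> ennreal (esc y)"
        using esc_step[OF 3] esc_nonneg
        by (subst nn_integral_clock_fst) (auto simp: ennreal_average intro!: ennreal_leI)
      show "(\<integral>\<^sup>+x. ?D x \<partial>clock) \<le> ennreal (th ^ Suc n * exp t)"
        by (rule clock_discount) (use th 3 in auto)
    qed
    finally show ?thesis by (simp add: add_ac del: late.simps)
  qed
qed

text \<open>An excursion starts at distance 1 from \<open>z\<close>, so every \<open>min\<close> in
  \<open>green\<close> is at most 1 and \<open>esc\<close> is at most \<open>1 / r\<close>.
  Integrating over \<open>{0..t}\<close> gives mean excursion length plus \<open>t / r\<close>,
  times the rate of leaving \<open>z\<close>.\<close>

lemma exc_le:
  assumes t: "0 \<le> t"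
  shows "exc n t \<le> ennreal ((2 * (\<Sum>u<z. s u) + 2 * (\<Sum>u\<in>{z<..<z + r}. s u) + t / r) / s z)"
proof -
  let ?G = "2 * (\<Sum>u<z. s u) + 2 * (\<Sum>u\<in>{z<..<z + r}. s u)"
  let ?y = "\<lambda>x::bool \<times> real. btm_step z (fst x)"
  have G0: "0 \<le> ?G" using pos by (intro add_nonneg_nonneg mult_nonneg_nonneg sum_nonneg) (auto intro: less_imp_le)
  have green: "green (btm_step z c) \<le> ?G" for c
  proof -
    have "real (min (z - u) (z - btm_step z c)) \<le> 1" "real (min (u - z) (btm_step z c - z)) \<le> 1" for u
      by (auto simp: btm_step_def)
    then have "2 * s u * real (min (z - u) (z - btm_step z c)) \<le> 2 * s u"
      "2 * s u * real (min (u - z) (btm_step z c - z)) \<le> 2 * s u" for u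
      using pos[of u] by (simp_all add: mult_left_le)
    then show ?thesis unfolding green_def sum_distrib_left by (intro add_mono sum_mono) auto
  qed
  have esc: "esc (btm_step z c) \<le> 1 / r" for c
    using r by (auto simp: esc_def btm_step_def of_nat_diff intro!: min.coboundedI2 divide_right_mono)
  have "(\<integral>\<^sup>+u. drift n u * indicator {0..t} u \<partial>lborel) =
      (\<integral>\<^sup>+u. \<integral>\<^sup>+x. (late n u (?y x) + ennreal (esc (?y x))) * (if 0 \<le> u \<and> u \<le> t then 1 else 0) \<partial>clock \<partial>lborel)"
    unfolding drift_def by (intro nn_integral_cong) (auto split: split_indicator)
  also have "\<dots> = (\<integral>\<^sup>+x. \<integral>\<^sup>+u. (late n u (?y x) + ennreal (esc (?y x))) * (if 0 \<le> u \<and> u \<le> t then 1 else 0) \<partial>lborel \<partial>clock)"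
  proof -
    interpret pair_sigma_finite clock lborel ..
    show ?thesis by (rule Fubini') measurable
  qed
  also have "\<dots> \<le> (\<integral>\<^sup>+x. ennreal (?G + t / r) \<partial>clock)"
  proof (rule nn_integral_mono)
    fix x
    have "(\<integral>\<^sup>+u. (late n u (?y x) + ennreal (esc (?y x))) * (if 0 \<le> u \<and> u \<le> t then 1 else 0) \<partial>lborel)
        \<le> (\<integral>\<^sup>+u. late n u (?y x) * indicator {0..} u + ennreal (1 / r) * indicator {0..t} u \<partial>lborel)"
      using esc[of "fst x"]
      by (intro nn_integral_mono) (auto split: split_indicator intro!: add_left_mono ennreal_leI)
    also have "\<dots> = (\<integral>\<^sup>+u. late n u (?y x) * indicator {0..} u \<partial>lborel) + (\<integral>\<^sup>+u. ennreal (1 / r) * indicator {0..t} u \<partial>lborel)"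
      by (rule nn_integral_add) measurable
    also have "(\<integral>\<^sup>+u. ennreal (1 / r) * indicator {0..t} u \<partial>lborel) = ennreal (t / r)"
      using t by (subst nn_integral_cmult) (auto simp: ennreal_mult'[symmetric])
    also have "(\<integral>\<^sup>+u. late n u (?y x) * indicator {0..} u \<partial>lborel) \<le> ennreal ?G"
      using late_integral[of n "?y x"] green[of "fst x"] by (auto intro: order_trans ennreal_leI)
    finally show "(\<integral>\<^sup>+u. (late n u (?y x) + ennreal (esc (?y x))) * (if 0 \<le> u \<and> u \<le> t then 1 else 0) \<partial>lborel)
        \<le> ennreal (?G + t / r)"
      using G0 t by (simp add: ennreal_plus)
  qed
  also have "\<dots> = ennreal (?G + t / r)" using clock.emeasure_space_1 by simp
  finally have int: "(\<integral>\<^sup>+u. drift n u * indicator {0..t} u \<partial>lborel) \<le> ennreal (?G + t / r)" .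
  have "exc n t = ennreal (btm_rate s z) * (\<integral>\<^sup>+u. drift n u * indicator {0..t} u \<partial>lborel)"
    unfolding exc_def mult.assoc by (rule nn_integral_cmult) measurable
  \<comment> \<open>The rate is \<open>1 / s z\<close>, or half of it when
    \<open>z = 0\<close>.\<close>
  also have "\<dots> \<le> ennreal (1 / s z) * ennreal (?G + t / r)"
    using pos[of 0] pos[of z]
    by (intro mult_mono int ennreal_leI) (auto simp: btm_rate_def field_simps)
  also have "\<dots> = ennreal ((?G + t / r) / s z)"
    using pos[of z] by (simp add: ennreal_mult'[symmetric])
  finally show ?thesis .
qed

text \<open>Markov's inequality: \<open>late\<close> decreases in time, so
  \<open>t * late n t 0\<close> is at most its time integral, hence at most \<open>green 0\<close>,
  where all distances are at most \<open>z\<close>.\<close>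

lemma late_le:
  assumes t: "0 < t"
  shows "late n t 0 \<le> ennreal (2 * real z * (\<Sum>u<z. s u) / t)"
proof (cases "z = 0 \<or> n = 0")
  case True
  then have "late n t 0 = 0"
  proof (cases n)
    case (Suc m)
    with True have "0 = z \<or> z + r \<le> 0" by simp
    then show ?thesis unfolding Suc late.simps by (rule if_P)
  qed simp
  then show ?thesis by simp
next
  case False
  have "ennreal t * late n t 0 = (\<integral>\<^sup>+u. late n t 0 * indicator {0..t} u \<partial>lborel)"
    using t by (subst nn_integral_cmult) (auto simp: mult.commute)
  also have "\<dots> \<le> (\<integral>\<^sup>+u. late n u 0 * indicator {0..} u \<partial>lborel)"
    by (intro nn_integral_mono) (auto split: split_indicator intro: late_antimono)
  also have "\<dots> \<le> ennreal (green 0)" by (rule late_integral)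
  also have "\<dots> \<le> ennreal (2 * real z * (\<Sum>u<z. s u))"
  proof (rule ennreal_leI)
    have "(\<Sum>u<z. 2 * s u * real (min (z - u) (z - 0))) \<le> (\<Sum>u<z. 2 * real z * s u)"
      using pos by (intro sum_mono) (auto simp: mult.commute of_nat_diff less_imp_le intro!: mult_left_mono)
    then show "green 0 \<le> 2 * real z * (\<Sum>u<z. s u)"
      unfolding green_def sum_distrib_left by simp
  qed
  finally have le: "ennreal t * late n t 0 \<le> ennreal (2 * real z * (\<Sum>u<z. s u))" .
  obtain q where q: "late n t 0 = ennreal q" "0 \<le> q"
    using late_le_1[of n t 0] by (cases "late n t 0") (auto simp: top_unique)
  have "0 \<le> 2 * real z * (\<Sum>u<z. s u)" using pos by (intro mult_nonneg_nonneg sum_nonneg) (auto intro: less_imp_le)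
  then have "t * q \<le> 2 * real z * (\<Sum>u<z. s u)"
    using le q t by (simp add: ennreal_mult'[symmetric])
  then show ?thesis using q t by (auto intro!: ennreal_leI simp: field_simps)
qed

lemma quenched_prob_lower:
  assumes t: "0 < t"
  shows "1 - quenched_prob s t z \<le> 2 * real z * (\<Sum>u<z. s u) / t +
    (2 * (\<Sum>u<z. s u) + 2 * (\<Sum>u\<in>{z<..<z + r}. s u) + t / r) / s z" (is "_ \<le> ?A + ?B")
proof -
  \<comment> \<open>The window is finite, so the worst discount factor is attained and lies below 1;
    letting \<open>n\<close> grow then removes the jump-counting error.\<close>
  define th where "th = Max ((\<lambda>y. btm_rate s y / (1 + btm_rate s y)) ` {..<z + r})"
  have ne: "{..<z + r} \<noteq> {}" using r by auto
  have le: "btm_rate s y / (1 + btm_rate s y) \<le> th" if "y < z + r" for y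
    unfolding th_def using that by (intro Max_ge) auto
  have "th \<in> (\<lambda>y. btm_rate s y / (1 + btm_rate s y)) ` {..<z + r}"
    unfolding th_def using ne by (intro Max_in) auto
  then obtain y where y: "th = btm_rate s y / (1 + btm_rate s y)" by auto
  have th: "0 \<le> th" "th < 1" unfolding y using rate_pos[of y] by auto
  have sums: "0 \<le> (\<Sum>u<z. s u)" "0 \<le> (\<Sum>u\<in>{z<..<z + r}. s u)"
    using pos by (auto intro!: sum_nonneg intro: less_imp_le)
  have A: "0 \<le> ?A" using sums t by auto
  have B: "0 \<le> ?B" using sums t pos[of z] by auto
  have "1 - quenched_prob s t z \<le> ?A + ?B + th ^ n * exp t" for n
  proof -
    have "ennreal (1 - quenched_prob s t z) \<le> miss_prob s z n t 0"
      by (rule quenched_prob_ge[OF sets_btm_pos])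
    also have "\<dots> \<le> late n t 0 + exc n t + ennreal (esc 0) + ennreal (th ^ n * exp t)"
      by (rule miss_prob_le) (use le th t in auto)
    also have "\<dots> \<le> ennreal ?A + ennreal ?B + 0 + ennreal (th ^ n * exp t)"
      using t by (intro add_mono late_le exc_le) (auto simp: esc_def)
    also have "\<dots> = ennreal (?A + ?B + th ^ n * exp t)"
      using A B th by (simp add: ennreal_plus)
    finally show ?thesis using A B th by (subst (asm) ennreal_le_iff) auto
  qed
  moreover have "(\<lambda>n. ?A + ?B + th ^ n * exp t) \<longlonglongrightarrow> ?A + ?B + 0 * exp t"
    using th by (intro tendsto_intros LIMSEQ_realpow_zero) auto
  ultimately show ?thesis
    by (intro LIMSEQ_le_const[where X = "\<lambda>n. ?A + ?B + th ^ n * exp t"]) auto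
qed

end

section \<open>The random landscape\<close>

lemma contraction_tendsto_0:
  fixes a c d :: "nat \<Rightarrow> real"
  assumes nonneg: "\<And>k. 0 \<le> a k" and rec: "\<And>k. a (Suc k) \<le> c k * a k + d k"
    and c: "c \<longlonglongrightarrow> 1 / 2" and d: "d \<longlonglongrightarrow> 0"
  shows "a \<longlonglongrightarrow> 0"
proof (rule tendstoI)
  fix e :: real assume e: "0 < e"
  \<comment> \<open>Any factor between \<open>1 / 2\<close> and 1 would do; \<open>e / 2\<close> is
    the fixed point of \<open>x -> 3 / 4 * x + e / 8\<close>.\<close>
  have "eventually (\<lambda>k. c k < 3 / 4 \<and> d k < e / 8) sequentially"
    using order_tendstoD(2)[OF c, of "3/4"] order_tendstoD(2)[OF d, of "e/8"] e
    by (intro eventually_conj) auto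
  then obtain K where K: "\<And>k. K \<le> k \<Longrightarrow> c k < 3 / 4 \<and> d k < e / 8"
    by (auto simp: eventually_sequentially)
  have bound: "a (m + K) \<le> e / 2 + (3 / 4) ^ m * a K" for m
  proof (induction m)
    case (Suc m)
    have "a (Suc (m + K)) \<le> 3 / 4 * a (m + K) + e / 8"
      using rec[of "m + K"] K[of "m + K"] nonneg[of "m + K"]
      by (smt (verit) le_add2 mult_right_mono)
    also have "\<dots> \<le> 3 / 4 * (e / 2 + (3 / 4) ^ m * a K) + e / 8"
      using Suc by simp
    finally show ?case by (simp add: field_simps)
  qed (use e in simp)
  have "(\<lambda>m. (3 / 4) ^ m * a K) \<longlonglongrightarrow> 0 * a K"
    by (intro tendsto_intros LIMSEQ_realpow_zero) auto
  then have "eventually (\<lambda>m. (3 / 4) ^ m * a K < e / 2) sequentially"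
    using order_tendstoD(2)[of _ 0 sequentially "e / 2"] e by simp
  then have "eventually (\<lambda>m. dist (a (m + K)) 0 < e) sequentially"
  proof eventually_elim
    case (elim m)
    then show ?case using bound[of m] nonneg[of "m + K"] by simp
  qed
  then show "eventually (\<lambda>k. dist (a k) 0 < e) sequentially"
    by (subst (asm) eventually_sequentially_seg)
qed

text \<open>Without a trap deeper than \<open>u\<close> the value is unspecified; such landscapes
  fall into the bad event \<open>?B1\<close> of \<open>prob_bad_landscape\<close>.\<close>

definition first_deep :: "real \<Rightarrow> (nat \<Rightarrow> real) \<Rightarrow> nat" where
  "first_deep u s = (LEAST x. s x > u)"

text \<open>Deep traps are dropped rather than capped, so a sum over the whole window skips the deep
  trap itself.\<close>

definition trunc :: "real \<Rightarrow> real \<Rightarrow> real" where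
  "trunc u v = (if v \<le> u then v else 0)"

lemma trunc_nonneg: "0 < v \<Longrightarrow> 0 \<le> trunc u v"
  by (simp add: trunc_def)

lemma measurable_trunc [measurable]: "trunc u \<in> borel_measurable borel"
  unfolding trunc_def by measurable

text \<open>Deterministic part: on a good landscape the other traps in the window are at most
  \<open>u\<close> deep, so both sums of \<open>quenched_prob_lower\<close> are truncated sums,
  bounded by \<open>h * u\<close>.\<close>

lemma quenched_prob_first_deep:
  assumes pos: "\<And>x. 0 < s x" and u: "0 < u" and A: "1 \<le> A" and r: "1 \<le> r" and t: "0 < t"
    and ex: "x0 < n" "u < s x0"
    and very_deep: "\<And>x. x < n \<Longrightarrow> u < s x \<Longrightarrow> A * u < s x"
    and sum: "(\<Sum>x<n + r. trunc u (s x)) \<le> h * u"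
    and isolated: "\<And>x y. x < n \<Longrightarrow> x < y \<Longrightarrow> y < x + r \<Longrightarrow> u < s x \<Longrightarrow> s y \<le> u"
  shows "1 - quenched_prob s t (first_deep u s) \<le> 2 * real n * (h * u) / t + (2 * (h * u) + t / r) / (A * u)"
proof -
  define z where "z = first_deep u s"
  have z: "u < s z" "z \<le> x0"
    using LeastI[of "\<lambda>x. u < s x", OF ex(2)] Least_le[of "\<lambda>x. u < s x", OF ex(2)]
    by (auto simp: z_def first_deep_def)
  have before: "s x \<le> u" if "x < z" for x
    using not_less_Least[of x "\<lambda>x. u < s x"] that by (auto simp: z_def first_deep_def)
  have zn: "z < n" using z ex by simp
  interpret trap_window s z r by unfold_locales (use pos r in auto)
  have split: "(\<Sum>x<z. s x) + (\<Sum>x\<in>{z<..<z + r}. s x) \<le> h * u"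
  proof -
    have "(\<Sum>x<z. s x) = (\<Sum>x<z. trunc u (s x))"
      using before by (intro sum.cong) (auto simp: trunc_def)
    moreover have "(\<Sum>x\<in>{z<..<z + r}. s x) = (\<Sum>x\<in>{z<..<z + r}. trunc u (s x))"
      using isolated[OF zn _ _ z(1)] by (intro sum.cong) (auto simp: trunc_def)
    ultimately have "(\<Sum>x<z. s x) + (\<Sum>x\<in>{z<..<z + r}. s x) = (\<Sum>x\<in>{..<z} \<union> {z<..<z + r}. trunc u (s x))"
      by (subst sum.union_disjoint) auto
    also have "\<dots> \<le> (\<Sum>x<n + r. trunc u (s x))"
      using zn pos by (intro sum_mono2) (auto simp: trunc_def less_imp_le)
    finally show ?thesis using sum by simp
  qed
  have nn: "0 \<le> (\<Sum>x<z. s x)" "0 \<le> (\<Sum>x\<in>{z<..<z + r}. s x)"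
    using pos by (auto intro!: sum_nonneg intro: less_imp_le)
  have "1 - quenched_prob s t z \<le> 2 * real z * (\<Sum>u<z. s u) / t +
      (2 * (\<Sum>u<z. s u) + 2 * (\<Sum>u\<in>{z<..<z + r}. s u) + t / r) / s z"
    by (rule quenched_prob_lower[OF t])
  also have "\<dots> \<le> 2 * real n * (h * u) / t + (2 * (h * u) + t / r) / (A * u)"
  proof (intro add_mono frac_le mult_mono)
    show "A * u \<le> s z" using very_deep[OF zn z(1)] by simp
  qed (use split nn zn t u A r in auto)
  finally show ?thesis unfolding z_def .
qed

section \<open>Tails and truncated means of the trap depths\<close>

locale trap_env = prob_space M for M :: "'w measure" +
  fixes \<sigma> :: "'w \<Rightarrow> nat \<Rightarrow> real" and q :: "real \<Rightarrow> real"
  assumes meas [measurable]: "\<And>x. (\<lambda>\<omega>. \<sigma> \<omega> x) \<in> borel_measurable M"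
    and indep: "indep_vars (\<lambda>_. borel) (\<lambda>x \<omega>. \<sigma> \<omega> x) UNIV"
    and ident: "\<And>x. distr M borel (\<lambda>\<omega>. \<sigma> \<omega> x) = distr M borel (\<lambda>\<omega>. \<sigma> \<omega> 0)"
    and pos: "\<And>\<omega> x. \<omega> \<in> space M \<Longrightarrow> 0 < \<sigma> \<omega> x"
    and q_def: "\<And>u. q u = prob {\<omega> \<in> space M. \<sigma> \<omega> 0 > u}"
    and q_pos: "\<And>u. 0 < q u"
    and slow: "\<And>v. 0 < v \<Longrightarrow> ((\<lambda>u. q u / q (u * v)) \<longlongrightarrow> 1) at_top"
begin

lemma prob_ident:
  assumes "A \<in> sets borel"
  shows "prob {\<omega> \<in> space M. \<sigma> \<omega> x \<in> A} = prob {\<omega> \<in> space M. \<sigma> \<omega> 0 \<in> A}"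
proof -
  have "measure (distr M borel (\<lambda>\<omega>. \<sigma> \<omega> x)) A = measure (distr M borel (\<lambda>\<omega>. \<sigma> \<omega> 0)) A"
    by (rule arg_cong[OF ident])
  then show ?thesis using assms by (simp add: measure_distr vimage_def Int_def conj_commute)
qed

lemma prob_tail: "prob {\<omega> \<in> space M. u < \<sigma> \<omega> x} = q u"
  using prob_ident[of "{u<..}" x] by (simp add: q_def)

lemma q_antimono: "u \<le> v \<Longrightarrow> q v \<le> q u"
  unfolding q_def by (intro finite_measure_mono) auto

lemma q_le_1: "q u \<le> 1"
  by (simp add: q_def)

lemma prob_window:
  assumes "u \<le> v"
  shows "prob {\<omega> \<in> space M. u < \<sigma> \<omega> x \<and> \<sigma> \<omega> x \<le> v} = q u - q v"
proof -
  have "prob ({\<omega> \<in> space M. u < \<sigma> \<omega> x} - {\<omega> \<in> space M. v < \<sigma> \<omega> x}) = q u - q v"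
    using assms by (subst finite_measure_Diff) (auto simp: prob_tail)
  also have "{\<omega> \<in> space M. u < \<sigma> \<omega> x} - {\<omega> \<in> space M. v < \<sigma> \<omega> x} =
      {\<omega> \<in> space M. u < \<sigma> \<omega> x \<and> \<sigma> \<omega> x \<le> v}" by auto
  finally show ?thesis .
qed

lemma prob_no_deep: "prob {\<omega> \<in> space M. \<forall>x<n. \<sigma> \<omega> x \<le> u} = (1 - q u) ^ n"
proof (cases "n = 0")
  case False
  have one: "prob ((\<lambda>\<omega>. \<sigma> \<omega> x) -` {..u} \<inter> space M) = 1 - q u" for x
  proof -
    have "(\<lambda>\<omega>. \<sigma> \<omega> x) -` {..u} \<inter> space M = space M - {\<omega> \<in> space M. u < \<sigma> \<omega> x}" by auto
    then show ?thesis by (subst prob_tail[symmetric, of u x]) (simp add: prob_compl)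
  qed
  have "{\<omega> \<in> space M. \<forall>x<n. \<sigma> \<omega> x \<le> u} = (\<Inter>x\<in>{..<n}. (\<lambda>\<omega>. \<sigma> \<omega> x) -` {..u} \<inter> space M)"
    using False by auto
  also have "prob \<dots> = (\<Prod>x\<in>{..<n}. prob ((\<lambda>\<omega>. \<sigma> \<omega> x) -` {..u} \<inter> space M))"
    using False by (intro indep_varsD[OF indep]) auto
  finally show ?thesis by (simp add: one)
qed (simp add: prob_space)

lemma prob_pair_deep:
  assumes "x \<noteq> y"
  shows "prob {\<omega> \<in> space M. u < \<sigma> \<omega> x \<and> u < \<sigma> \<omega> y} = q u ^ 2"
proof -
  have "{\<omega> \<in> space M. u < \<sigma> \<omega> x \<and> u < \<sigma> \<omega> y} = (\<Inter>i\<in>{x, y}. (\<lambda>\<omega>. \<sigma> \<omega> i) -` {u<..} \<inter> space M)"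
    by auto
  also have "prob \<dots> = (\<Prod>i\<in>{x, y}. prob ((\<lambda>\<omega>. \<sigma> \<omega> i) -` {u<..} \<inter> space M))"
    by (intro indep_varsD[OF indep]) auto
  also have "\<dots> = (\<Prod>i\<in>{x, y}. q u)"
    by (intro prod.cong refl, subst prob_tail[symmetric]) (auto intro!: arg_cong[where f = prob])
  finally show ?thesis using assms by (simp add: power2_eq_square)
qed

lemma integrable_trunc: "integrable M (\<lambda>\<omega>. trunc u (\<sigma> \<omega> x))"
  by (rule integrable_const_bound[where B = "\<bar>u\<bar>"])
     (auto simp: trunc_def less_imp_le[OF pos] abs_of_pos[OF pos] intro!: AE_I2 order_trans[OF _ abs_ge_self])

definition tmean :: "real \<Rightarrow> real" where
  "tmean u = expectation (\<lambda>\<omega>. trunc u (\<sigma> \<omega> 0))"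

lemma expectation_trunc: "expectation (\<lambda>\<omega>. trunc u (\<sigma> \<omega> x)) = tmean u"
proof -
  have "integral\<^sup>L (distr M borel (\<lambda>\<omega>. \<sigma> \<omega> x)) (trunc u) = integral\<^sup>L (distr M borel (\<lambda>\<omega>. \<sigma> \<omega> 0)) (trunc u)"
    by (rule arg_cong[OF ident])
  then show ?thesis by (simp add: integral_distr tmean_def)
qed

lemma tmean_nonneg: "0 \<le> tmean u"
  unfolding tmean_def
  by (intro integral_nonneg_AE AE_I2) (auto simp: trunc_def less_imp_le[OF pos])

text \<open>The two truncations differ only on depths in \<open>(u, 2 * u]\<close>, and there by at
  most \<open>2 * u\<close>.\<close>

lemma tmean_double:
  assumes "0 < u"
  shows "tmean (2 * u) \<le> tmean u + 2 * u * (q u - q (2 * u))"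
proof -
  let ?W = "{\<omega> \<in> space M. u < \<sigma> \<omega> 0 \<and> \<sigma> \<omega> 0 \<le> 2 * u}"
  have "tmean (2 * u) \<le> expectation (\<lambda>\<omega>. trunc u (\<sigma> \<omega> 0) + 2 * u * indicator ?W \<omega>)"
    unfolding tmean_def
    by (intro integral_mono integrable_trunc Bochner_Integration.integrable_add integrable_mult_right
          integrable_real_indicator)
       (use assms in \<open>auto simp: trunc_def emeasure_eq_measure split: split_indicator\<close>)
  also have "\<dots> = tmean u + 2 * u * prob ?W"
    unfolding tmean_def
    by (subst Bochner_Integration.integral_add) (auto simp: integrable_trunc emeasure_eq_measure)
  also have "prob ?W = q u - q (2 * u)" using assms by (intro prob_window) simp
  finally show ?thesis .
qed

lemma filterlim_pow2: "filterlim (\<lambda>k. 2 ^ k :: real) at_top sequentially"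
  unfolding filterlim_at_top
proof
  fix Z :: real
  obtain K where "Z < 2 ^ K" using real_arch_pow[of 2 Z] by auto
  then have "Z \<le> 2 ^ k" if "K \<le> k" for k
    using \<open>Z < 2 ^ K\<close> power_increasing[OF that, of "2::real"] by linarith
  then show "eventually (\<lambda>k. Z \<le> 2 ^ k) sequentially"
    by (auto simp: eventually_sequentially)
qed

lemma slow_pow2: "0 < v \<Longrightarrow> (\<lambda>k. q (2 ^ k) / q (2 ^ k * v)) \<longlonglongrightarrow> 1"
  using filterlim_compose[OF slow filterlim_pow2] .

text \<open>Hence the traps below the level \<open>u = 2\<^sup>k\<close> contribute \<open>o(u)\<close> to a sum over \<open>O(1 / q u)\<close>
  sites. Along powers of two this needs slow variation at the scale ratio 2 only, and no uniform
  convergence theorem.\<close>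
lemma tmean_negligible: "(\<lambda>k. tmean (2 ^ k) / (2 ^ k * q (2 ^ k))) \<longlonglongrightarrow> 0"
proof (rule contraction_tendsto_0)
  let ?rho = "\<lambda>k. q (2 ^ k) / q (2 ^ k * 2)"
  show "0 \<le> tmean (2 ^ k) / (2 ^ k * q (2 ^ k))" for k
    using tmean_nonneg q_pos[of "2 ^ k"] by simp
  \<comment> \<open>\<open>tmean_double\<close> divided by the new normalisation: doubling the level
    halves the ratio, up to the factor \<open>?rho k\<close>, which tends to 1.\<close>
  show "tmean (2 ^ Suc k) / (2 ^ Suc k * q (2 ^ Suc k)) \<le>
      ?rho k / 2 * (tmean (2 ^ k) / (2 ^ k * q (2 ^ k))) + (?rho k - 1)" for k
  proof -
    have "tmean (2 ^ Suc k) / (2 ^ Suc k * q (2 ^ Suc k)) \<le>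
        (tmean (2 ^ k) + 2 * 2 ^ k * (q (2 ^ k) - q (2 * 2 ^ k))) / (2 ^ Suc k * q (2 ^ Suc k))"
      using tmean_double[of "2 ^ k"] q_pos[of "2 ^ Suc k"] by (intro divide_right_mono) auto
    also have "\<dots> = ?rho k / 2 * (tmean (2 ^ k) / (2 ^ k * q (2 ^ k))) + (?rho k - 1)"
      using q_pos[of "2 ^ k"] q_pos[of "2 * 2 ^ k"] by (simp add: field_simps)
    finally show ?thesis .
  qed
  show "(\<lambda>k. ?rho k / 2) \<longlonglongrightarrow> 1 / 2" by (intro tendsto_divide slow_pow2) auto
  show "(\<lambda>k. ?rho k - 1) \<longlonglongrightarrow> 0" using tendsto_diff[OF slow_pow2[of 2] tendsto_const[of 1]] by simp
qed

section \<open>Vanishing tails and the choice of the level\<close>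

lemma q_tendsto_0: "(\<lambda>k. q (2 ^ k)) \<longlonglongrightarrow> 0"
proof -
  let ?A = "\<lambda>k. {\<omega> \<in> space M. 2 ^ k < \<sigma> \<omega> 0}"
  have "(\<lambda>k. prob (?A k)) \<longlonglongrightarrow> prob (\<Inter>k. ?A k)"
  proof (rule finite_Lim_measure_decseq)
    show "range ?A \<subseteq> sets M" by auto
    show "decseq ?A"
      by (intro antimonoI) (auto intro: le_less_trans[OF power_increasing])
  qed
  moreover have "(\<Inter>k. ?A k) = {}"
  proof -
    have "\<exists>k. \<not> 2 ^ k < y" for y :: real
      using real_arch_pow[of 2 y] by (auto intro: less_asym)
    then show ?thesis by fastforce
  qed
  ultimately show ?thesis by (simp add: q_def)
qed

text \<open>\<open>u / q u\<close> is a depth times the mean spacing of the traps deeper than it.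
  The level \<open>2 ^ k\<close> is the first whose scale reaches \<open>t\<close>.\<close>

definition level :: "real \<Rightarrow> nat" where
  "level t = (LEAST k. t \<le> 2 ^ k / q (2 ^ k))"

lemma le_level: "t \<le> 2 ^ level t / q (2 ^ level t)"
proof -
  obtain k where "t < 2 ^ k" using real_arch_pow[of 2 t] by auto
  also have "2 ^ k \<le> 2 ^ k / q (2 ^ k)"
    using q_pos[of "2 ^ k"] q_le_1[of "2 ^ k"] by (simp add: field_simps)
  finally have "t \<le> 2 ^ k / q (2 ^ k)" by simp
  then show ?thesis unfolding level_def by (rule LeastI)
qed

lemma filterlim_level: "filterlim level at_top at_top"
  unfolding filterlim_at_top
proof
  fix K :: nat
  show "eventually (\<lambda>t. K \<le> level t) at_top"
    using eventually_gt_at_top[of "Max ((\<lambda>k. 2 ^ k / q (2 ^ k)) ` {..K})"]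
  proof eventually_elim
    case (elim t)
    show ?case
    proof (rule ccontr)
      assume "\<not> K \<le> level t"
      then have "2 ^ level t / q (2 ^ level t) \<le> Max ((\<lambda>k. 2 ^ k / q (2 ^ k)) ` {..K})"
        by (intro Max_ge) auto
      with elim le_level[of t] show False by linarith
    qed
  qed
qed

text \<open>The preceding power of two is still below \<open>t\<close>, and by slow variation one
  doubling eventually multiplies the scale by at most 4.\<close>

lemma level_le: "eventually (\<lambda>t. 2 ^ level t / q (2 ^ level t) \<le> 4 * t) at_top"
proof -
  have "eventually (\<lambda>k. q (2 ^ k) / q (2 ^ k * 2) < 2) sequentially"
    using order_tendstoD(2)[OF slow_pow2[of 2], of 2] by simp
  then obtain K where K: "\<And>k. K \<le> k \<Longrightarrow> q (2 ^ k) / q (2 ^ k * 2) < 2"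
    by (auto simp: eventually_sequentially)
  have "eventually (\<lambda>t. Suc K \<le> level t) at_top"
    using filterlim_level by (simp add: filterlim_at_top)
  then show ?thesis
  proof eventually_elim
    case (elim t)
    then obtain k where k: "level t = Suc k" "K \<le> k" by (cases "level t") auto
    have "\<not> t \<le> 2 ^ k / q (2 ^ k)"
      using not_less_Least[of k "\<lambda>k. t \<le> 2 ^ k / q (2 ^ k)"] k by (simp add: level_def)
    moreover have "2 ^ Suc k / q (2 ^ Suc k) = 2 * (q (2 ^ k) / q (2 ^ k * 2)) * (2 ^ k / q (2 ^ k))"
      using q_pos[of "2 ^ k"] by (simp add: field_simps)
    moreover have "\<dots> \<le> 2 * 2 * (2 ^ k / q (2 ^ k))"
      using K[OF k(2)] q_pos[of "2 ^ k"] by (intro mult_right_mono) auto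
    ultimately show ?case unfolding k(1) by linarith
  qed
qed

lemma prob_bad_landscape:
  fixes n r :: nat
  assumes u: "0 < u" and A: "1 \<le> A" and r: "1 \<le> r" and t: "0 < t" and h: "0 < h"
    and bound: "2 * real n * (h * u) / t + (2 * (h * u) + t / r) / (A * u) \<le> e"
  shows "prob {\<omega> \<in> space M. e < 1 - quenched_prob (\<sigma> \<omega>) t (first_deep u (\<sigma> \<omega>))} \<le>
    (1 - q u) ^ n + n * (q u - q (A * u)) + (n + r) * tmean u / (h * u) + n * r * (q u)\<^sup>2"
proof -
  \<comment> \<open>Four ways to fail: no deep trap among the first \<open>n\<close> sites, a deep
    trap that is not very deep, too much shallow mass (bounded by Markov), two deep traps closer
    than \<open>r\<close>.\<close>
  let ?B1 = "{\<omega> \<in> space M. \<forall>x<n. \<sigma> \<omega> x \<le> u}"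
  let ?B2 = "\<Union>x<n. {\<omega> \<in> space M. u < \<sigma> \<omega> x \<and> \<sigma> \<omega> x \<le> A * u}"
  let ?S = "\<lambda>\<omega>. \<Sum>x<n + r. trunc u (\<sigma> \<omega> x)"
  let ?B3 = "{\<omega> \<in> space M. h * u \<le> ?S \<omega>}"
  let ?B4 = "\<Union>x<n. \<Union>y\<in>{x<..<x + r}. {\<omega> \<in> space M. u < \<sigma> \<omega> x \<and> u < \<sigma> \<omega> y}"
  have "{\<omega> \<in> space M. e < 1 - quenched_prob (\<sigma> \<omega>) t (first_deep u (\<sigma> \<omega>))} \<subseteq> ?B1 \<union> ?B2 \<union> ?B3 \<union> ?B4"
  proof
    fix \<omega> assume \<omega>: "\<omega> \<in> {\<omega> \<in> space M. e < 1 - quenched_prob (\<sigma> \<omega>) t (first_deep u (\<sigma> \<omega>))}"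
    show "\<omega> \<in> ?B1 \<union> ?B2 \<union> ?B3 \<union> ?B4"
    proof (rule ccontr)
      assume *: "\<omega> \<notin> ?B1 \<union> ?B2 \<union> ?B3 \<union> ?B4"
      then have "\<omega> \<notin> ?B1" by blast
      then obtain x0 where x0: "x0 < n" "u < \<sigma> \<omega> x0" using \<omega> by (auto simp: not_le)
      have "1 - quenched_prob (\<sigma> \<omega>) t (first_deep u (\<sigma> \<omega>)) \<le>
          2 * real n * (h * u) / t + (2 * (h * u) + t / r) / (A * u)"
      proof (rule quenched_prob_first_deep[where s = "\<sigma> \<omega>", OF _ u A r t x0])
        show "0 < \<sigma> \<omega> x" for x using \<omega> pos by simp
        show "A * u < \<sigma> \<omega> x" if "x < n" "u < \<sigma> \<omega> x" for x
        proof (rule ccontr)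
          assume "\<not> A * u < \<sigma> \<omega> x"
          then have "\<omega> \<in> ?B2" using that \<omega> by (intro UN_I[of x]) auto
          with * show False by blast
        qed
        show "(\<Sum>x<n + r. trunc u (\<sigma> \<omega> x)) \<le> h * u"
        proof (rule ccontr)
          assume "\<not> ?S \<omega> \<le> h * u"
          then have "\<omega> \<in> ?B3" using \<omega> by simp
          with * show False by blast
        qed
        show "\<sigma> \<omega> y \<le> u" if "x < n" "x < y" "y < x + r" "u < \<sigma> \<omega> x" for x y
        proof (rule ccontr)
          assume "\<not> \<sigma> \<omega> y \<le> u"
          then have "\<omega> \<in> ?B4" using that \<omega> by (intro UN_I[of x] UN_I[of y]) auto
          with * show False by blast
        qed
      qed
      with bound \<omega> show False by simp
    qed
  qed
  then have "prob {\<omega> \<in> space M. e < 1 - quenched_prob (\<sigma> \<omega>) t (first_deep u (\<sigma> \<omega>))} \<le> prob (?B1 \<union> ?B2 \<union> ?B3 \<union> ?B4)"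
    by (intro finite_measure_mono) (simp, measurable)
  also have "\<dots> \<le> prob ?B1 + prob ?B2 + prob ?B3 + prob ?B4"
  proof -
    have "prob (?B1 \<union> ?B2 \<union> ?B3 \<union> ?B4) \<le> prob (?B1 \<union> ?B2 \<union> ?B3) + prob ?B4"
      "prob (?B1 \<union> ?B2 \<union> ?B3) \<le> prob (?B1 \<union> ?B2) + prob ?B3"
      "prob (?B1 \<union> ?B2) \<le> prob ?B1 + prob ?B2"
      by (intro measure_Un_le; measurable)+
    then show ?thesis by linarith
  qed
  also have "\<dots> \<le> (1 - q u) ^ n + n * (q u - q (A * u)) + (n + r) * tmean u / (h * u) + n * r * (q u)\<^sup>2"
  proof (intro add_mono)
    show "prob ?B1 \<le> (1 - q u) ^ n" by (simp add: prob_no_deep)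
    have "prob ?B2 \<le> (\<Sum>x<n. prob {\<omega> \<in> space M. u < \<sigma> \<omega> x \<and> \<sigma> \<omega> x \<le> A * u})"
      by (intro finite_measure_subadditive_finite) auto
    also have "\<dots> = (\<Sum>x<n. q u - q (A * u))"
      using u A by (intro sum.cong refl prob_window) simp
    finally show "prob ?B2 \<le> n * (q u - q (A * u))" by simp
    have "prob ?B3 \<le> expectation ?S / (h * u)"
      by (rule integral_Markov_inequality_measure[where A = "space M", simplified])
         (use u h in \<open>auto intro!: AE_I2 sum_nonneg integrable_trunc trunc_nonneg pos\<close>)
    also have "expectation ?S = (n + r) * tmean u"
      by (subst Bochner_Integration.integral_sum) (auto simp: integrable_trunc expectation_trunc)
    finally show "prob ?B3 \<le> (n + r) * tmean u / (h * u)" .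
    have "prob ?B4 \<le> (\<Sum>x<n. prob (\<Union>y\<in>{x<..<x + r}. {\<omega> \<in> space M. u < \<sigma> \<omega> x \<and> u < \<sigma> \<omega> y}))"
      by (intro finite_measure_subadditive_finite) auto
    also have "\<dots> \<le> (\<Sum>x<n. \<Sum>y\<in>{x<..<x + r}. prob {\<omega> \<in> space M. u < \<sigma> \<omega> x \<and> u < \<sigma> \<omega> y})"
      by (intro sum_mono finite_measure_subadditive_finite) auto
    also have "\<dots> = (\<Sum>x<n. \<Sum>y\<in>{x<..<x + r}. (q u)\<^sup>2)"
      by (intro sum.cong refl prob_pair_deep) auto
    also have "\<dots> \<le> (\<Sum>x<n. r * (q u)\<^sup>2)"
      by (intro sum_mono) (auto intro!: mult_right_mono)
    finally show "prob ?B4 \<le> n * r * (q u)\<^sup>2" by simp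
  qed
  finally show ?thesis .
qed

lemma measurable_first_deep:
  "first_deep u \<in> measurable (PiM UNIV (\<lambda>_::nat. borel)) (count_space UNIV)"
  unfolding first_deep_def by measurable

lemma localisation:
  assumes e: "0 < e" and kap: "0 < kap"
  shows "eventually (\<lambda>t. prob {\<omega> \<in> space M.
      e < 1 - quenched_prob (\<sigma> \<omega>) t (first_deep (2 ^ level t) (\<sigma> \<omega>))} \<le> kap) at_top"
proof -
  \<comment> \<open>\<open>K\<close> makes a deep trap likely, \<open>d\<close> makes two close ones
    unlikely, \<open>A\<close> controls escape, and \<open>h\<close> controls hitting and excursion
    times. All are fixed before \<open>t\<close> grows, so slow variation is used at the fixed ratio
    \<open>A\<close> only.\<close>
  define K where "K = max 1 (ln (4 / kap))"
  define d where "d = min 1 (kap / (16 * K))"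
  define A where "A = max 1 (4 / (d * e))"
  define h where "h = min (e / (64 * K)) (e / 16)"
  have K: "1 \<le> K" "exp (- K) \<le> kap / 4"
  proof -
    have "exp (- K) \<le> exp (- ln (4 / kap))" by (simp add: K_def)
    also have "\<dots> = kap / 4" using kap by (simp add: exp_minus)
    finally show "exp (- K) \<le> kap / 4" .
  qed (simp add: K_def)
  have d: "0 < d" "d \<le> 1" "4 * K * d \<le> kap / 4"
  proof -
    have "d \<le> kap / (16 * K)" by (simp add: d_def)
    then show "4 * K * d \<le> kap / 4" using K by (simp add: field_simps)
  qed (use kap K in \<open>auto simp: d_def\<close>)
  have A: "1 \<le> A" "1 / (d * A) \<le> e / 4"
  proof -
    have "4 / (d * e) \<le> A" by (simp add: A_def)
    moreover have "0 < A" by (simp add: A_def)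
    ultimately show "1 / (d * A) \<le> e / 4" using d e by (simp add: field_simps)
  qed (simp add: A_def)
  have h: "0 < h" "16 * K * h \<le> e / 4" "2 * h \<le> e / 8"
  proof -
    have "h \<le> e / (64 * K)" by (simp add: h_def)
    then show "16 * K * h \<le> e / 4" using K by (simp add: field_simps)
  qed (use e K in \<open>auto simp: h_def\<close>)
  have "(\<lambda>k. 2 * K * (1 - inverse (q (2 ^ k) / q (2 ^ k * A)))) \<longlonglongrightarrow> 2 * K * (1 - inverse 1)"
    using A by (intro tendsto_intros slow_pow2) auto
  then have ev1: "eventually (\<lambda>k. 2 * K * (1 - inverse (q (2 ^ k) / q (2 ^ k * A))) < kap / 4) sequentially"
    using kap by (intro order_tendstoD(2)) auto
  have "(\<lambda>k. (2 * K + 2 * d) / h * (tmean (2 ^ k) / (2 ^ k * q (2 ^ k)))) \<longlonglongrightarrow> (2 * K + 2 * d) / h * 0"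
    by (intro tendsto_intros tmean_negligible)
  then have ev2: "eventually (\<lambda>k. (2 * K + 2 * d) / h * (tmean (2 ^ k) / (2 ^ k * q (2 ^ k))) < kap / 4) sequentially"
    using kap by (intro order_tendstoD(2)) auto
  have ev3: "eventually (\<lambda>k. q (2 ^ k) < d) sequentially"
    using d by (intro order_tendstoD(2)[OF q_tendsto_0])
  have ev: "eventually (\<lambda>t. 2 * K * (1 - inverse (q (2 ^ level t) / q (2 ^ level t * A))) < kap / 4 \<and>
      (2 * K + 2 * d) / h * (tmean (2 ^ level t) / (2 ^ level t * q (2 ^ level t))) < kap / 4 \<and>
      q (2 ^ level t) < d) at_top"
    by (rule eventually_compose_filterlim[OF _ filterlim_level])
       (intro eventually_conj ev1 ev2 ev3)
  show ?thesis
    using ev level_le eventually_gt_at_top[of 0]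
  proof eventually_elim
    case (elim t)
    let ?u = "2 ^ level t :: real"
    \<comment> \<open>Rounding up costs at most a factor 2, since \<open>q ?u\<close> is at most
      \<open>K\<close> and at most \<open>d\<close>.\<close>
    let ?n = "nat \<lceil>K / q ?u\<rceil>" and ?r = "nat \<lceil>d / q ?u\<rceil>"
    have q: "0 < q ?u" by (rule q_pos)
    have n: "K \<le> ?n * q ?u" "?n * q ?u \<le> 2 * K"
    proof -
      have "K / q ?u \<le> ?n" by linarith
      then show "K \<le> ?n * q ?u" using q by (simp add: field_simps)
      have "0 \<le> K / q ?u" using K q by simp
      then have "?n \<le> K / q ?u + 1" by linarith
      then have "?n * q ?u \<le> (K / q ?u + 1) * q ?u" using q by (intro mult_right_mono) auto
      also have "\<dots> = K + q ?u" using q by (simp add: field_simps)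
      finally show "?n * q ?u \<le> 2 * K" using K q_le_1[of ?u] by simp
    qed
    have r: "d / q ?u \<le> ?r" "?r * q ?u \<le> 2 * d" "1 \<le> ?r"
    proof -
      show "d / q ?u \<le> ?r" by linarith
      have "0 < d / q ?u" using d q by simp
      then have "?r \<le> d / q ?u + 1" by linarith
      then have "?r * q ?u \<le> (d / q ?u + 1) * q ?u" using q by (intro mult_right_mono) auto
      also have "\<dots> = d + q ?u" using q by (simp add: field_simps)
      finally show "?r * q ?u \<le> 2 * d" using elim by simp
      show "1 \<le> ?r" using \<open>0 < d / q ?u\<close> by linarith
    qed
    have b1: "2 * real ?n * (h * ?u) / t \<le> e / 4"
    proof -
      \<comment> \<open>The hitting-time term uses the upper comparison of the level scale with
        \<open>t\<close>, from \<open>level_le\<close>.\<close>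
      have "2 * real ?n * (h * ?u) / t = 2 * h * (real ?n * q ?u) * (?u / q ?u / t)"
        using q by (simp add: field_simps)
      also have "\<dots> \<le> 2 * h * (2 * K) * 4"
      proof (rule mult_mono)
        show "2 * h * (real ?n * q ?u) \<le> 2 * h * (2 * K)"
          using n(2) h by (intro mult_left_mono) auto
        show "?u / q ?u / t \<le> 4" using elim by (simp only: pos_divide_le_eq)
      qed (use h K q elim in auto)
      also have "\<dots> \<le> e / 4" using h by (simp add: mult_ac)
      finally show ?thesis .
    qed
    have b2: "(2 * (h * ?u) + t / ?r) / (A * ?u) \<le> e / 8 + e / 4"
    proof -
      \<comment> \<open>The escape term uses the lower comparison, from
        \<open>le_level\<close>.\<close>
      have "t / ?r \<le> (?u / q ?u) / (d / q ?u)"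
        using le_level[of t] r d q elim by (intro frac_le) auto
      also have "\<dots> = ?u / d" using q d by simp
      finally have "(2 * (h * ?u) + t / ?r) / (A * ?u) \<le> (2 * (h * ?u) + ?u / d) / (A * ?u)"
        using A by (intro divide_right_mono add_left_mono) auto
      also have "\<dots> = 2 * h / A + 1 / (d * A)" using A d by (simp add: field_simps)
      also have "2 * h / A \<le> 2 * h / 1" using A h by (intro divide_left_mono) auto
      finally show ?thesis using A h by linarith
    qed
    have "prob {\<omega> \<in> space M. e < 1 - quenched_prob (\<sigma> \<omega>) t (first_deep ?u (\<sigma> \<omega>))} \<le>
        (1 - q ?u) ^ ?n + ?n * (q ?u - q (A * ?u)) + (?n + ?r) * tmean ?u / (h * ?u) + ?n * ?r * (q ?u)\<^sup>2"
    proof (rule prob_bad_landscape)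
      show "2 * real ?n * (h * ?u) / t + (2 * (h * ?u) + t / ?r) / (A * ?u) \<le> e"
        using b1 b2 e by linarith
    qed (use A r h elim in auto)
    also have "\<dots> \<le> kap / 4 + kap / 4 + kap / 4 + kap / 4"
    proof (intro add_mono)
      have "(1 - q ?u) ^ ?n \<le> exp (- q ?u) ^ ?n"
        using q_le_1[of ?u] exp_ge_add_one_self[of "- q ?u"] by (intro power_mono) auto
      also have "\<dots> = exp (- (?n * q ?u))" by (simp add: exp_of_nat_mult[symmetric])
      also have "\<dots> \<le> exp (- K)" using n by simp
      finally show "(1 - q ?u) ^ ?n \<le> kap / 4" using K by simp
      \<comment> \<open>Rewritten so that slow variation at ratio \<open>A\<close> makes the second
        factor small.\<close>
      have "?n * (q ?u - q (A * ?u)) = (?n * q ?u) * (1 - inverse (q ?u / q (?u * A)))"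
        using q by (simp add: field_simps)
      also have "\<dots> \<le> 2 * K * (1 - inverse (q ?u / q (?u * A)))"
      proof (rule mult_right_mono[OF n(2)])
        show "0 \<le> 1 - inverse (q ?u / q (?u * A))"
          using q q_antimono[of ?u "?u * A"] A by (simp add: field_simps)
      qed
      finally show "?n * (q ?u - q (A * ?u)) \<le> kap / 4" using elim by simp
      have "(?n + ?r) * tmean ?u / (h * ?u) = (?n * q ?u + ?r * q ?u) / h * (tmean ?u / (?u * q ?u))"
        using q h(1) by (simp add: field_simps)
      also have "\<dots> \<le> (2 * K + 2 * d) / h * (tmean ?u / (?u * q ?u))"
        using h(1) q tmean_nonneg[of ?u]
        by (intro mult_right_mono divide_right_mono add_mono n(2) r(2)) auto
      finally show "(?n + ?r) * tmean ?u / (h * ?u) \<le> kap / 4"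
        by (rule order_trans) (use elim in simp)
      have "?n * ?r * (q ?u)\<^sup>2 = (?n * q ?u) * (?r * q ?u)" by (simp add: power2_eq_square)
      also have "\<dots> \<le> (2 * K) * (2 * d)"
        by (rule mult_mono[OF n(2) r(2)]) (use K q in auto)
      finally show "?n * ?r * (q ?u)\<^sup>2 \<le> kap / 4"
        by (rule order_trans) (use d(3) in simp)
    qed
    finally show ?case by simp
  qed
qed

end

theorem theorem1p1:
  fixes M :: "'w measure" and \<sigma> :: "'w \<Rightarrow> nat \<Rightarrow> real" and L :: "real \<Rightarrow> real"
  assumes "prob_space M"
    and "\<And>x. (\<lambda>\<omega>. \<sigma> \<omega> x) \<in> borel_measurable M"
    and "prob_space.indep_vars M (\<lambda>_. borel) (\<lambda>x \<omega>. \<sigma> \<omega> x) UNIV"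
    and "\<And>x. distr M borel (\<lambda>\<omega>. \<sigma> \<omega> x) = distr M borel (\<lambda>\<omega>. \<sigma> \<omega> 0)"
    and "\<And>\<omega> x. \<omega> \<in> space M \<Longrightarrow> \<sigma> \<omega> x > 0"
    and "\<And>u. measure M {\<omega> \<in> space M. \<sigma> \<omega> 0 > u} > 0"
    and "\<And>u. L u = 1 / measure M {\<omega> \<in> space M. \<sigma> \<omega> 0 > u}"
    and "\<And>v. v > 0 \<Longrightarrow> ((\<lambda>u. L (u * v) / L u) \<longlongrightarrow> 1) at_top"
  shows "\<exists>Z :: real \<Rightarrow> (nat \<Rightarrow> real) \<Rightarrow> nat.
           (\<forall>t\<ge>0. Z t \<in> measurable (PiM UNIV (\<lambda>_::nat. borel)) (count_space UNIV)) \<and>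
           (\<forall>t\<ge>0. \<forall>\<epsilon>>0. {\<omega> \<in> space M. \<bar>quenched_prob (\<sigma> \<omega>) t (Z t (\<sigma> \<omega>)) - 1\<bar> > \<epsilon>} \<in> sets M) \<and>
           (\<forall>\<epsilon>>0. ((\<lambda>t. measure M {\<omega> \<in> space M.
                 \<bar>quenched_prob (\<sigma> \<omega>) t (Z t (\<sigma> \<omega>)) - 1\<bar> > \<epsilon>}) \<longlongrightarrow> 0) at_top)"
proof -
  define q where "q u = measure M {\<omega> \<in> space M. \<sigma> \<omega> 0 > u}" for u
  interpret trap_env M \<sigma> q
  proof (intro trap_env.intro trap_env_axioms.intro)
    \<comment> \<open>Since \<open>L\<close> is the reciprocal of \<open>q\<close>, the ratio
      \<open>L (u * v) / L u\<close> becomes \<open>q u / q (u * v)\<close>.\<close>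
    show "((\<lambda>u. q u / q (u * v)) \<longlongrightarrow> 1) at_top" if "0 < v" for v
      using assms(8)[OF that] by (simp add: assms(7) q_def)
  qed (use assms q_def in auto)
  note [measurable] = measurable_first_deep
  have [measurable]: "\<sigma> \<in> measurable M (PiM UNIV (\<lambda>_. borel))"
    by (rule measurable_PiM_single') (use assms(2) in auto)
  have [measurable]: "(\<lambda>\<omega>. quenched_prob (\<sigma> \<omega>) t (first_deep u (\<sigma> \<omega>))) \<in> borel_measurable M" for t u
    by (rule measurable_quenched_prob) (use assms(2) in measurable)
  \<comment> \<open>Probabilities are at most 1, so the two-sided deviation is the one-sided
    quantity bounded in \<open>localisation\<close>.\<close>
  have abs: "\<bar>quenched_prob s t z - 1\<bar> = 1 - quenched_prob s t z" for s t z
    using quenched_prob_le_1[of s t z] by simp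
  show ?thesis
  proof (intro exI[of _ "\<lambda>t. first_deep (2 ^ level t)"] conjI allI impI)
    fix e :: real assume e: "0 < e"
    show "((\<lambda>t. measure M {\<omega> \<in> space M.
        \<bar>quenched_prob (\<sigma> \<omega>) t (first_deep (2 ^ level t) (\<sigma> \<omega>)) - 1\<bar> > e}) \<longlongrightarrow> 0) at_top"
      unfolding abs
    proof (rule tendstoI)
      fix kap :: real assume "0 < kap"
      then show "eventually (\<lambda>t. dist (prob {\<omega> \<in> space M.
          e < 1 - quenched_prob (\<sigma> \<omega>) t (first_deep (2 ^ level t) (\<sigma> \<omega>))}) 0 < kap) at_top"
        using localisation[OF e, of "kap / 2"] by (auto elim: eventually_mono)
    qed
  qed (measurable)
qed

end
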